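(* Let $(W,S)$ be a Coxeter system with Davis complex $\Sigma$ and Coxeter-cell skeleta $\Sigma_n$. Let $M$ be any left Bredon module over $\mathcal{O}_{\mathfrak{Fin}(W)}W$. For each spherical $T$, let $M_T$ denote the restriction of $M$ to $W_T$, i.e. $M_T(W_T/K)=M(W/K)$ for $K\le W_T$, with the induced maps. Then for every $n\ge 0$ and every degree $i$, $$H^{\mathfrak{Fin}(W)}_i(\Sigma_n,\Sigma_{n-1};M)\;\cong\;\bigoplus_{T\in\mathcal S,\ |T|=n} H^{\mathfrak{Fin}(W_T)}_i\big(C_{W_T},\partial C_{W_T};M_T\big).$$ On the left the homology is taken with respect to the $W$-action. On the right it is taken with respect to the $W_T$-action on the Coxeter cell $C_{W_T}$ and the family of all subgroups of the finite group $W_T$. All spaces are given the $G$-CW-structure of their barycentric subdivisions.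
   Context: Bredon homology. Let $G$ be a discrete group and $\mathfrak F$ a family of subgroups closed under conjugation and passing to subgroups. The orbit category $\mathcal O_{\mathfrak F}G$ has objects $G/K$ with $K\in\mathfrak F$, and morphisms the $G$-maps. A $G$-map $R_g\colon G/K\to G/L$, $R_g(K)=gL$, exists exactly when $g^{-1}Kg\subseteq L$. A left Bredon module is a covariant functor $\mathcal O_{\mathfrak F}G\to\mathfrak{Ab}$. A $G$-CW-complex is a CW-complex with a cell-permuting $G$-action such that any element mapping a cell to itself fixes it pointwise. For a $G$-CW-complex $X$ with all stabilizers in $\mathfrak F$, choose orbit representatives $e_\alpha$ of $d$-cells with stabilizers $S_\alpha$ and set $C_d=\bigoplus_\alpha M(G/S_\alpha)$. The differential is induced by the incidence numbers of the cellular boundary: for a face $g\cdot e'$ of $e_\alpha$ one has $g^{-1}S_\alpha g\subseteq \mathrm{stab}(e')$, and the corresponding component is $M(R_g)$. Then $H^{\mathfrak F}_i(X;M)$ is the homology of this complex. For a $G$-subcomplex $A$, the relative groups $H^{\mathfrak F}_i(X,A;M)$ are the homology of the analogous complex built only on the cells of $X$ not in $A$. The result is independent of $\mathfrak F$ as long as $\mathfrak F$ contains all isotropy groups. $\mathfrak{Fin}(G)$ denotes the family of finite subgroups. Coxeter groups. A Coxeter system $(W,S)$ has $S=\{s_1,\dots,s_N\}$ finite and $W=\langle s_1,\dots,s_N\mid (s_is_j)^{m_{ij}}=1\rangle$, where $m_{ii}=1$ and $m_{ij}=m_{ji}\in\{2,3,\dots\}\cup\{\infty\}$ for $i\ne j$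 ($\infty$ means no relation). For $T\subseteq S$, the special subgroup is $W_T=\langle T\rangle$, and $(W_T,T)$ is a Coxeter system. $T$ is spherical if $W_T$ is finite, $\mathcal S$ is the set of spherical subsets (including $\varnothing$), and $\mathrm{rank}(T)=|T|$. Coxeter cells. For a finite Coxeter group $W$ with $|S|=N$, the Coxeter cell $C_W\subset\mathbb R^N$ is the convex hull of the orbit $Wx$ of a point $x$ in the interior of the fundamental chamber of the canonical reflection representation $W\to GL_N(\mathbb R)$. Its faces correspond bijectively and inclusion-preservingly to the cosets $wW_T$ ($T\subseteq S$): the face for $wW_T$ is the convex hull of $wW_Tx$, which is a copy $wC_{W_T}$ of the Coxeter cell of $W_T$. $\partial C_W$ denotes its topological boundary in $\mathbb R^N$. Davis complex. $W\mathcal S=\bigsqcup_{T\in\mathcal S}W/W_T$ is the poset of spherical cosets under inclusion, with $W$ acting by left multiplication. $\Sigma$ is its geometric realization. For $T\in\mathcal S$ and $w\in W$, the subcomplex $|(W\mathcal S)_{\le wW_T}|$ is identified with the barycentric subdivision of a copy $C_{wW_T}=wC_{W_T}$ of the Coxeter cell of $W_T$, so that $\Sigma=\bigcup_{T\in\mathcal S,\,wW_T\in W/W_T}C_{wW_T}$. For $n\ge -1$, $\Sigma_n$ is the union of the $C_{wW_T}$ with $T\in\mathcal S$ and $|T|\le n$; in particular $\Sigma_{-1}=\varnothing$. *)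

theory Defs
  imports "HOL-Algebra.Algebra" "HOL-Library.Extended_Nat"
begin

text \<open>A Coxeter matrix on the index set {0..<N} (S = {s_0,...,s_(N-1)}); the value
  infinity of type enat means "no relation".\<close>
definition coxeter_matrix :: "nat \<Rightarrow> (nat \<Rightarrow> nat \<Rightarrow> enat) \<Rightarrow> bool" where
  "coxeter_matrix N m \<longleftrightarrow>
     (\<forall>i<N. m i i = 1) \<and> (\<forall>i<N. \<forall>j<N. m i j = m j i) \<and>
     (\<forall>i<N. \<forall>j<N. i \<noteq> j \<longrightarrow> 2 \<le> m i j)"

definition cox_relators :: "nat \<Rightarrow> (nat \<Rightarrow> nat \<Rightarrow> enat) \<Rightarrow> nat list set" where
  "cox_relators N m = {concat (replicate k [i, j]) | i j k. i < N \<and> j < N \<and> m i j = enat k}"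

text \<open>The congruence on words generated by the relators.  Since every generator is an
  involution (s_i s_i is a relator), the group presented by the Coxeter presentation is
  the monoid of words modulo this congruence.\<close>
inductive cox_eq :: "nat \<Rightarrow> (nat \<Rightarrow> nat \<Rightarrow> enat) \<Rightarrow> nat list \<Rightarrow> nat list \<Rightarrow> bool"
  for N m where
  refl: "cox_eq N m w w"
| sym: "cox_eq N m u v \<Longrightarrow> cox_eq N m v u"
| trans: "cox_eq N m u v \<Longrightarrow> cox_eq N m v w \<Longrightarrow> cox_eq N m u w"
| rel: "r \<in> cox_relators N m \<Longrightarrow> cox_eq N m (u @ r @ v) (u @ v)"

definition cox_class :: "nat \<Rightarrow> (nat \<Rightarrow> nat \<Rightarrow> enat) \<Rightarrow> nat list \<Rightarrow> nat list set" where
  "cox_class N m w = {v \<in> lists {0..<N}. cox_eq N m v w}"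

definition cox_mult :: "nat \<Rightarrow> (nat \<Rightarrow> nat \<Rightarrow> enat) \<Rightarrow> nat list set \<Rightarrow> nat list set \<Rightarrow> nat list set" where
  "cox_mult N m Xc Y = cox_class N m ((SOME x. x \<in> Xc) @ (SOME y. y \<in> Y))"

definition coxeter_group :: "nat \<Rightarrow> (nat \<Rightarrow> nat \<Rightarrow> enat) \<Rightarrow> nat list set monoid" where
  "coxeter_group N m =
     \<lparr>carrier = cox_class N m ` lists {0..<N}, monoid.mult = cox_mult N m, one = cox_class N m []\<rparr>"

definition cox_gen :: "nat \<Rightarrow> (nat \<Rightarrow> nat \<Rightarrow> enat) \<Rightarrow> nat \<Rightarrow> nat list set" where
  "cox_gen N m i = cox_class N m [i]"

definition special_subgroup :: "nat \<Rightarrow> (nat \<Rightarrow> nat \<Rightarrow> enat) \<Rightarrow> nat set \<Rightarrow> nat list set set" where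
  "special_subgroup N m T = generate (coxeter_group N m) (cox_gen N m ` T)"

definition special_group :: "nat \<Rightarrow> (nat \<Rightarrow> nat \<Rightarrow> enat) \<Rightarrow> nat set \<Rightarrow> nat list set monoid" where
  "special_group N m T = subgroup_generated (coxeter_group N m) (cox_gen N m ` T)"

definition spherical :: "nat \<Rightarrow> (nat \<Rightarrow> nat \<Rightarrow> enat) \<Rightarrow> nat set \<Rightarrow> bool" where
  "spherical N m T \<longleftrightarrow> T \<subseteq> {0..<N} \<and> finite (special_subgroup N m T)"

text \<open>Simplices of the order complex (barycentric subdivision) of a poset with strict
  order less and vertex set V: nonempty strictly increasing lists (a d-simplex has d+1
  vertices and carries the orientation given by the order).\<close>
definition order_chains :: "('v \<Rightarrow> 'v \<Rightarrow> bool) \<Rightarrow> 'v set \<Rightarrow> 'v list set" where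
  "order_chains lt V = {c. c \<noteq> [] \<and> set c \<subseteq> V \<and> sorted_wrt lt c}"

definition stab :: "('g, 'm) monoid_scheme \<Rightarrow> ('g \<Rightarrow> 'v \<Rightarrow> 'v) \<Rightarrow> 'v list \<Rightarrow> 'g set" where
  "stab G act c = {g \<in> carrier G. map (act g) c = c}"

definition orb :: "('g, 'm) monoid_scheme \<Rightarrow> ('g \<Rightarrow> 'v \<Rightarrow> 'v) \<Rightarrow> 'v list \<Rightarrow> 'v list set" where
  "orb G act c = {map (act g) c | g. g \<in> carrier G}"

definition orep :: "('g, 'm) monoid_scheme \<Rightarrow> ('g \<Rightarrow> 'v \<Rightarrow> 'v) \<Rightarrow> 'v list \<Rightarrow> 'v list" where
  "orep G act c = (SOME c'. c' \<in> orb G act c)"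

definition rel_cells :: "'v list set \<Rightarrow> 'v list set \<Rightarrow> nat \<Rightarrow> 'v list set" where
  "rel_cells Xc A d = {c \<in> Xc - A. length c = Suc d}"

definition cell_reps :: "('g, 'm) monoid_scheme \<Rightarrow> ('g \<Rightarrow> 'v \<Rightarrow> 'v) \<Rightarrow> 'v list set \<Rightarrow> 'v list set \<Rightarrow> nat \<Rightarrow> 'v list set" where
  "cell_reps G act Xc A d = orep G act ` rel_cells Xc A d"

definition face :: "nat \<Rightarrow> 'v list \<Rightarrow> 'v list" where
  "face j c = take j c @ drop (Suc j) c"

text \<open>Left Bredon module over the orbit category O_F G: Mobj K = M(G/K) and
  Mmap K L g = M(R_g) for R_g : G/K \<rightarrow> G/L, R_g(K) = gL (defined when g^-1 K g \<subseteq> L).\<close>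
definition conj_sub :: "('g, 'm) monoid_scheme \<Rightarrow> 'g \<Rightarrow> 'g set \<Rightarrow> 'g set" where
  "conj_sub G g K = (\<lambda>k. inv\<^bsub>G\<^esub> g \<otimes>\<^bsub>G\<^esub> k \<otimes>\<^bsub>G\<^esub> g) ` K"

definition bredon_module ::
  "('g, 'm) monoid_scheme \<Rightarrow> 'g set set \<Rightarrow> ('g set \<Rightarrow> 'b monoid) \<Rightarrow> ('g set \<Rightarrow> 'g set \<Rightarrow> 'g \<Rightarrow> 'b \<Rightarrow> 'b) \<Rightarrow> bool" where
  "bredon_module G F Mobj Mmap \<longleftrightarrow>
     (\<forall>K\<in>F. comm_group (Mobj K)) \<and>
     (\<forall>K\<in>F. \<forall>L\<in>F. \<forall>g\<in>carrier G. conj_sub G g K \<subseteq> L \<longrightarrow>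
         Mmap K L g \<in> hom (Mobj K) (Mobj L)) \<and>
     (\<forall>K\<in>F. \<forall>L\<in>F. \<forall>g\<in>carrier G. \<forall>g'\<in>carrier G.
         conj_sub G g K \<subseteq> L \<longrightarrow> g <#\<^bsub>G\<^esub> L = g' <#\<^bsub>G\<^esub> L \<longrightarrow>
         (\<forall>x\<in>carrier (Mobj K). Mmap K L g x = Mmap K L g' x)) \<and>
     (\<forall>K\<in>F. \<forall>x\<in>carrier (Mobj K). Mmap K K \<one>\<^bsub>G\<^esub> x = x) \<and>
     (\<forall>K\<in>F. \<forall>L\<in>F. \<forall>P\<in>F. \<forall>g\<in>carrier G. \<forall>h\<in>carrier G.
         conj_sub G g K \<subseteq> L \<longrightarrow> conj_sub G h L \<subseteq> P \<longrightarrow>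
         (\<forall>x\<in>carrier (Mobj K). Mmap L P h (Mmap K L g x) = Mmap K P (g \<otimes>\<^bsub>G\<^esub> h) x))"

definition fin_subgroups :: "('g, 'm) monoid_scheme \<Rightarrow> 'g set set" where
  "fin_subgroups G = {K. subgroup K G \<and> finite K}"

definition bredon_chains ::
  "('g, 'm) monoid_scheme \<Rightarrow> ('g \<Rightarrow> 'v \<Rightarrow> 'v) \<Rightarrow> 'v list set \<Rightarrow> 'v list set \<Rightarrow>
   ('g set \<Rightarrow> 'b monoid) \<Rightarrow> nat \<Rightarrow> ('v list \<Rightarrow> 'b) monoid" where
  "bredon_chains G act Xc A Mobj d = sum_group (cell_reps G act Xc A d) (\<lambda>\<alpha>. Mobj (stab G act \<alpha>))"

text \<open>Differential C_(d+1) \<rightarrow> C_d: the j-th face of e_alpha (incidence (-1)^j), if it is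
  not in A, equals g e_beta for the representative e_beta of its orbit; the component is
  M(R_g) : M(G/S_alpha) \<rightarrow> M(G/S_beta).\<close>
definition bredon_bd ::
  "('g, 'm) monoid_scheme \<Rightarrow> ('g \<Rightarrow> 'v \<Rightarrow> 'v) \<Rightarrow> 'v list set \<Rightarrow> 'v list set \<Rightarrow>
   ('g set \<Rightarrow> 'b monoid) \<Rightarrow> ('g set \<Rightarrow> 'g set \<Rightarrow> 'g \<Rightarrow> 'b \<Rightarrow> 'b) \<Rightarrow> nat \<Rightarrow>
   ('v list \<Rightarrow> 'b) \<Rightarrow> ('v list \<Rightarrow> 'b)" where
  "bredon_bd G act Xc A Mobj Mmap d x =
     (\<lambda>\<beta>\<in>cell_reps G act Xc A d.
        finprod (Mobj (stab G act \<beta>))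
          (\<lambda>(\<alpha>, j). Mmap (stab G act \<alpha>) (stab G act \<beta>)
                       (SOME g. g \<in> carrier G \<and> map (act g) \<beta> = face j \<alpha>) (x \<alpha>)
                     [^]\<^bsub>Mobj (stab G act \<beta>)\<^esub> ((-1) ^ j :: int))
          {(\<alpha>, j). \<alpha> \<in> cell_reps G act Xc A (Suc d) \<and> x \<alpha> \<noteq> \<one>\<^bsub>Mobj (stab G act \<alpha>)\<^esub> \<and>
                   j \<le> Suc d \<and> face j \<alpha> \<in> rel_cells Xc A d \<and> orep G act (face j \<alpha>) = \<beta>})"

definition bredon_homology ::
  "('g, 'm) monoid_scheme \<Rightarrow> ('g \<Rightarrow> 'v \<Rightarrow> 'v) \<Rightarrow> 'v list set \<Rightarrow> 'v list set \<Rightarrow>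
   ('g set \<Rightarrow> 'b monoid) \<Rightarrow> ('g set \<Rightarrow> 'g set \<Rightarrow> 'g \<Rightarrow> 'b \<Rightarrow> 'b) \<Rightarrow> nat \<Rightarrow>
   ('v list \<Rightarrow> 'b) set monoid" where
  "bredon_homology G act Xc A Mobj Mmap i =
     (let C = bredon_chains G act Xc A Mobj;
          Z = (case i of 0 \<Rightarrow> carrier (C 0)
               | Suc k \<Rightarrow> kernel (C (Suc k)) (C k) (bredon_bd G act Xc A Mobj Mmap k));
          B = bredon_bd G act Xc A Mobj Mmap i ` carrier (C (Suc i))
      in (C i)\<lparr>carrier := Z\<rparr> Mod B)"

text \<open>Vertices of the Davis complex: the poset WS of spherical cosets w W_T, tagged by T
  (disjoint union over T), ordered by inclusion; W acts by left multiplication.\<close>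
definition davis_vertices :: "nat \<Rightarrow> (nat \<Rightarrow> nat \<Rightarrow> enat) \<Rightarrow> (nat list set set \<times> nat set) set" where
  "davis_vertices N m =
     {(w <#\<^bsub>coxeter_group N m\<^esub> special_subgroup N m T, T) | w T.
        w \<in> carrier (coxeter_group N m) \<and> spherical N m T}"

definition coset_less :: "(nat list set set \<times> nat set) \<Rightarrow> (nat list set set \<times> nat set) \<Rightarrow> bool" where
  "coset_less p q \<longleftrightarrow> fst p \<subset> fst q"

definition coset_act :: "nat \<Rightarrow> (nat \<Rightarrow> nat \<Rightarrow> enat) \<Rightarrow> nat list set \<Rightarrow>
    (nat list set set \<times> nat set) \<Rightarrow> (nat list set set \<times> nat set)" where
  "coset_act N m g p = (g <#\<^bsub>coxeter_group N m\<^esub> fst p, snd p)"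

text \<open>Sigma_n (n an integer \<ge> -1): the union of the cells C_(wW_T) = |(WS)_(\<le> wW_T)|
  with |T| \<le> n, as a set of simplices of the barycentric subdivision.\<close>
definition davis_skeleton :: "nat \<Rightarrow> (nat \<Rightarrow> nat \<Rightarrow> enat) \<Rightarrow> int \<Rightarrow> (nat list set set \<times> nat set) list set" where
  "davis_skeleton N m n =
     {c \<in> order_chains coset_less (davis_vertices N m).
        \<exists>q\<in>davis_vertices N m. int (card (snd q)) \<le> n \<and> (\<forall>p\<in>set c. fst p \<subseteq> fst q)}"

text \<open>Face poset of the Coxeter cell C_(W_T) of (W_T, T): cosets w W_U, w \<in> W_T, U \<subseteq> T.\<close>
definition cell_vertices :: "nat \<Rightarrow> (nat \<Rightarrow> nat \<Rightarrow> enat) \<Rightarrow> nat set \<Rightarrow> (nat list set set \<times> nat set) set" where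
  "cell_vertices N m T =
     {(w <#\<^bsub>coxeter_group N m\<^esub> special_subgroup N m U, U) | w U.
        w \<in> special_subgroup N m T \<and> U \<subseteq> T}"

definition coxeter_cell :: "nat \<Rightarrow> (nat \<Rightarrow> nat \<Rightarrow> enat) \<Rightarrow> nat set \<Rightarrow> (nat list set set \<times> nat set) list set" where
  "coxeter_cell N m T = order_chains coset_less (cell_vertices N m T)"

definition coxeter_cell_boundary :: "nat \<Rightarrow> (nat \<Rightarrow> nat \<Rightarrow> enat) \<Rightarrow> nat set \<Rightarrow> (nat list set set \<times> nat set) list set" where
  "coxeter_cell_boundary N m T =
     {c \<in> coxeter_cell N m T.
        \<exists>q\<in>cell_vertices N m T. fst q \<subset> special_subgroup N m T \<and> (\<forall>p\<in>set c. fst p \<subseteq> fst q)}"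

end

theory Submission
  imports Defs Complex_Main
begin

text \<open>A cell of the barycentric subdivision lies in \<open>\<Sigma>\<^sub>n\<close> but not in \<open>\<Sigma>\<^sub>n\<^sub>-\<^sub>1\<close> precisely when its top vertex
  is a coset \<open>w W\<^sub>T\<close> with \<open>|T| = n\<close>. Translating by the inverse of \<open>w\<close> moves it to a cell of the Coxeter cell of
  \<open>W\<^sub>T\<close> with top vertex \<open>W\<^sub>T\<close> itself, i.e. not in the boundary; an element of \<open>W\<close> that maps one such cell to another
  must stabilise \<open>W\<^sub>T\<close> and so lies in \<open>W\<^sub>T\<close>. Thus the relative cells of the skeleta are induced from those of the
  Coxeter cells, with the same stabilisers, and the two Bredon chain complexes are isomorphic: orbit
  representatives are compared through the isomorphisms \<open>M(R\<^sub>g)\<close> given by group elements moving one to the other.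
  That \<open>|T|\<close> is determined by the coset rests on \<open>s\<^sub>i \<notin> W\<^sub>T\<close> for \<open>i \<notin> T\<close>, which is seen in
  the dual of the geometric representation.\<close>

section \<open>Quotients and finite direct sums\<close>

text \<open>Orbit representatives on the two sides come from unrelated choices, one inside
  \<open>W\<close>-orbits and one inside \<open>W_T\<close>-orbits, and so do the group elements
  that enter the two differentials. These choices cannot be matched. What can be used is that
  \<open>M(R_g)\<close> depends only on the coset \<open>g L\<close>, hence only on the cell to
  which \<open>g\<close> carries a representative; each comparison of coefficients is reduced to two
  elements that carry one cell to the same cell.

  The differential respects the splitting because a face survives in the relative complex only if it
  keeps the top vertex: without it, the new top coset is strictly smaller and has fewer than
  \<open>n\<close> generators, so the face lies in the smaller skeleton.

  The contragredient is preferred to the geometric representation itself because it always contains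
  a vector that is fixed by all generators but one, namely a vector of the basis dual to the simple
  roots. When the bilinear form is degenerate, the geometric representation may contain no such
  vector.\<close>

lemma (in comm_group) group_subgroup_Mod:
  assumes Z: "subgroup Z G" and B: "subgroup B G"
  shows "group (G\<lparr>carrier := Z\<rparr> Mod B)"
proof -
  have "B \<lhd> G" using B by (simp add: normal_iff_subgroup)
  then interpret normal B G .
  interpret h: group_hom G "G Mod B" "\<lambda>x. B #> x"
    by (simp add: group_hom_def group_hom_axioms_def factorgroup_is_group r_coset_hom_Mod)
  have "group ((G Mod B)\<lparr>carrier := (\<lambda>x. B #> x) ` Z\<rparr>)"
    by (rule subgroup.subgroup_is_group[OF h.subgroup_img_is_subgroup[OF Z] factorgroup_is_group])
  \<comment> \<open>Restricting the carrier leaves the multiplication alone, and cosets and products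
    of sets are computed from the multiplication only.\<close>
  moreover have "(G Mod B)\<lparr>carrier := (\<lambda>x. B #> x) ` Z\<rparr> = G\<lparr>carrier := Z\<rparr> Mod B"
    by (auto simp: FactGroup_def RCOSETS_def r_coset_def set_mult_def fun_eq_iff)
  ultimately show ?thesis by simp
qed

text \<open>If \<open>B\<close> is not contained in \<open>Z\<close>, then \<open>Z Mod B\<close> is the image of \<open>Z\<close> in the quotient by \<open>B\<close>.\<close>
lemma iso_Mod_product:
  fixes C :: "('c, 'm) monoid_scheme" and D :: "'t \<Rightarrow> ('d, 'n) monoid_scheme"
  assumes "finite I"
    and D: "\<And>T. T \<in> I \<Longrightarrow> comm_group (D T)"
    and hom: "\<And>T. T \<in> I \<Longrightarrow> \<phi> T \<in> hom C (D T)"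
    and C: "group C"
    and bij: "bij_betw (\<lambda>x. \<lambda>T\<in>I. \<phi> T x) (carrier C) (\<Pi>\<^sub>E T\<in>I. carrier (D T))"
    and Z': "\<And>T. T \<in> I \<Longrightarrow> subgroup (Z' T) (D T)"
    and B': "\<And>T. T \<in> I \<Longrightarrow> subgroup (B' T) (D T)"
    and Z: "Z = {x \<in> carrier C. \<forall>T\<in>I. \<phi> T x \<in> Z' T}"
    and B: "B = {x \<in> carrier C. \<forall>T\<in>I. \<phi> T x \<in> B' T}"
  shows "C\<lparr>carrier := Z\<rparr> Mod B \<cong> sum_group I (\<lambda>T. (D T)\<lparr>carrier := Z' T\<rparr> Mod B' T)"
proof -
  interpret C: group C by (rule C)
  let ?Q = "\<lambda>T. (D T)\<lparr>carrier := Z' T\<rparr> Mod B' T"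
  let ?f = "(\<lambda>V. (\<lambda>T\<in>I. \<phi> T ` V))"
  have grpQ: "group (?Q T)" if "T \<in> I" for T
    using comm_group.group_subgroup_Mod D Z' B' that by blast
  have carr: "carrier (sum_group I ?Q) = (\<Pi>\<^sub>E T\<in>I. carrier (?Q T))"
    using \<open>finite I\<close> by (subst carrier_sum_group) (auto simp: grpQ)
  have hm: "\<phi> T (x \<otimes>\<^bsub>C\<^esub> y) = \<phi> T x \<otimes>\<^bsub>D T\<^esub> \<phi> T y"
    if "T \<in> I" "x \<in> carrier C" "y \<in> carrier C" for T x y
    using hom[OF that(1)] that by (auto simp: hom_def)
  have cl: "\<phi> T x \<in> carrier (D T)" if "T \<in> I" "x \<in> carrier C" for T x
    using hom[OF that(1)] that by (auto simp: hom_def)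
  \<comment> \<open>Surjectivity of the joint map: coordinates can be prescribed independently of
    each other.\<close>
  have lift: "\<exists>x\<in>carrier C. \<forall>T\<in>I. \<phi> T x = y T" if "\<And>T. T \<in> I \<Longrightarrow> y T \<in> carrier (D T)" for y
  proof -
    have "restrict y I \<in> (\<lambda>x. \<lambda>T\<in>I. \<phi> T x) ` carrier C"
      using bij that by (auto simp: bij_betw_def)
    then obtain x where "x \<in> carrier C" "restrict y I = (\<lambda>T\<in>I. \<phi> T x)" by blast
    then show ?thesis by (metis restrict_apply')
  qed
  have sep: "x = y" if "x \<in> carrier C" "y \<in> carrier C" "\<And>T. T \<in> I \<Longrightarrow> \<phi> T x = \<phi> T y" for x y
    using that bij unfolding bij_betw_def inj_on_def by (metis (no_types, lifting) restrict_ext)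
  have Z'c: "Z' T \<subseteq> carrier (D T)" and B'c: "B' T \<subseteq> carrier (D T)" if "T \<in> I" for T
    using Z' B' that subgroup.subset by blast+
  \<comment> \<open>Coordinates of a coset fill a whole coset; the nontrivial inclusion needs
    elements of \<open>B\<close> with a prescribed coordinate.\<close>
  have img: "\<phi> T ` (B #>\<^bsub>C\<^esub> z) = B' T #>\<^bsub>D T\<^esub> \<phi> T z" if T: "T \<in> I" and z: "z \<in> carrier C" for T z
  proof
    show "\<phi> T ` (B #>\<^bsub>C\<^esub> z) \<subseteq> B' T #>\<^bsub>D T\<^esub> \<phi> T z"
      using T z by (auto simp: r_coset_def B hm)
    show "B' T #>\<^bsub>D T\<^esub> \<phi> T z \<subseteq> \<phi> T ` (B #>\<^bsub>C\<^esub> z)"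
    proof
      fix u assume "u \<in> B' T #>\<^bsub>D T\<^esub> \<phi> T z"
      then obtain b where b: "b \<in> B' T" "u = b \<otimes>\<^bsub>D T\<^esub> \<phi> T z" by (auto simp: r_coset_def)
      \<comment> \<open>With \<open>b\<close> at \<open>T\<close> and trivial coordinates elsewhere,
        \<open>x\<close> lies in \<open>B\<close> and realises any given element of
        \<open>B' T\<close>.\<close>
      obtain x where x: "x \<in> carrier C" "\<forall>U\<in>I. \<phi> U x = (if U = T then b else \<one>\<^bsub>D U\<^esub>)"
        using lift[of "\<lambda>U. if U = T then b else \<one>\<^bsub>D U\<^esub>"] b B'c B' T
        by (metis (no_types, lifting) in_mono subgroup.one_closed)
      then have "x \<in> B" using b B' by (auto simp: B subgroup.one_closed)
      moreover have "u = \<phi> T (x \<otimes>\<^bsub>C\<^esub> z)" using x b T z by (simp add: hm)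
      ultimately show "u \<in> \<phi> T ` (B #>\<^bsub>C\<^esub> z)" by (auto simp: r_coset_def)
    qed
  qed
  \<comment> \<open>A coset of \<open>B\<close> is recovered from its coordinate images, because
    membership in \<open>B\<close> is decided coordinate by coordinate. This gives injectivity of
    the map on quotients.\<close>
  have char: "B #>\<^bsub>C\<^esub> z = {x \<in> carrier C. \<forall>T\<in>I. \<phi> T x \<in> \<phi> T ` (B #>\<^bsub>C\<^esub> z)}" if z: "z \<in> carrier C" for z
  proof
    show "B #>\<^bsub>C\<^esub> z \<subseteq> {x \<in> carrier C. \<forall>T\<in>I. \<phi> T x \<in> \<phi> T ` (B #>\<^bsub>C\<^esub> z)}"
      using z by (auto simp: r_coset_def B)
    show "{x \<in> carrier C. \<forall>T\<in>I. \<phi> T x \<in> \<phi> T ` (B #>\<^bsub>C\<^esub> z)} \<subseteq> B #>\<^bsub>C\<^esub> z"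
    proof clarify
      fix x assume x: "x \<in> carrier C" and "\<forall>T\<in>I. \<phi> T x \<in> \<phi> T ` (B #>\<^bsub>C\<^esub> z)"
      then have "\<forall>T\<in>I. \<exists>b. b \<in> B' T \<and> \<phi> T x = b \<otimes>\<^bsub>D T\<^esub> \<phi> T z"
        using img[OF _ z] by (auto simp: r_coset_def)
      then obtain b where b: "\<And>T. T \<in> I \<Longrightarrow> b T \<in> B' T \<and> \<phi> T x = b T \<otimes>\<^bsub>D T\<^esub> \<phi> T z" by metis
      then obtain a where a: "a \<in> carrier C" "\<forall>T\<in>I. \<phi> T a = b T" using lift[of b] B'c by blast
      then have "a \<in> B" using b by (auto simp: B)
      moreover have "x = a \<otimes>\<^bsub>C\<^esub> z" using sep x a z b by (simp add: hm)
      ultimately show "x \<in> B #>\<^bsub>C\<^esub> z" by (auto simp: r_coset_def)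
    qed
  qed
  have carrQ: "V \<in> carrier (C\<lparr>carrier := Z\<rparr> Mod B) \<longleftrightarrow> (\<exists>z\<in>Z. V = B #>\<^bsub>C\<^esub> z)" for V
    by (auto simp: FactGroup_def RCOSETS_def r_coset_def)
  have carrQ': "V \<in> carrier (?Q T) \<longleftrightarrow> (\<exists>z\<in>Z' T. V = B' T #>\<^bsub>D T\<^esub> z)" for V T
    by (auto simp: FactGroup_def RCOSETS_def r_coset_def)
  have sub: "V \<subseteq> carrier C" if "V \<in> carrier (C\<lparr>carrier := Z\<rparr> Mod B)" for V
    using that unfolding carrQ by (auto simp: r_coset_def B Z)
  have "?f \<in> hom (C\<lparr>carrier := Z\<rparr> Mod B) (sum_group I ?Q)"
  proof (rule homI)
    fix V assume "V \<in> carrier (C\<lparr>carrier := Z\<rparr> Mod B)"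
    then show "?f V \<in> carrier (sum_group I ?Q)"
      unfolding carr carrQ by (auto simp: Z carrQ' img) blast
  next
    fix V W assume V: "V \<in> carrier (C\<lparr>carrier := Z\<rparr> Mod B)" and W: "W \<in> carrier (C\<lparr>carrier := Z\<rparr> Mod B)"
    have "\<phi> T ` (V <#>\<^bsub>C\<^esub> W) = \<phi> T ` V <#>\<^bsub>D T\<^esub> \<phi> T ` W" if "T \<in> I" for T
      using sub[OF V] sub[OF W] that
      by (auto simp: set_mult_def hm subset_iff image_iff; metis hm)
    then show "?f (V \<otimes>\<^bsub>C\<lparr>carrier := Z\<rparr> Mod B\<^esub> W) = ?f V \<otimes>\<^bsub>sum_group I ?Q\<^esub> ?f W"
      by (auto simp: fun_eq_iff set_mult_def)
  qed
  moreover have "inj_on ?f (carrier (C\<lparr>carrier := Z\<rparr> Mod B))"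
  proof (rule inj_onI)
    fix V W assume V: "V \<in> carrier (C\<lparr>carrier := Z\<rparr> Mod B)" and W: "W \<in> carrier (C\<lparr>carrier := Z\<rparr> Mod B)"
      and eq: "?f V = ?f W"
    have e: "\<phi> T ` V = \<phi> T ` W" if "T \<in> I" for T using fun_cong[OF eq, of T] that by simp
    have char': "U = {x \<in> carrier C. \<forall>T\<in>I. \<phi> T x \<in> \<phi> T ` U}"
      if U: "U \<in> carrier (C\<lparr>carrier := Z\<rparr> Mod B)" for U
    proof -
      obtain z where z: "z \<in> Z" "U = B #>\<^bsub>C\<^esub> z" using U unfolding carrQ by blast
      show ?thesis unfolding z(2) by (rule char) (use z(1) Z in blast)
    qed
    have "V = {x \<in> carrier C. \<forall>T\<in>I. \<phi> T x \<in> \<phi> T ` V}" by (rule char'[OF V])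
    also have "\<dots> = {x \<in> carrier C. \<forall>T\<in>I. \<phi> T x \<in> \<phi> T ` W}" using e by auto
    also have "\<dots> = W" by (rule char'[OF W, symmetric])
    finally show "V = W" .
  qed
  moreover have "carrier (sum_group I ?Q) \<subseteq> ?f ` carrier (C\<lparr>carrier := Z\<rparr> Mod B)"
  proof
    fix q assume q: "q \<in> carrier (sum_group I ?Q)"
    then have "\<forall>T\<in>I. q T \<in> carrier (?Q T)" unfolding carr by (simp add: PiE_iff)
    then obtain z where z: "\<And>T. T \<in> I \<Longrightarrow> z T \<in> Z' T \<and> q T = B' T #>\<^bsub>D T\<^esub> z T"
      unfolding carrQ' Bex_def by metis
    then obtain x where x: "x \<in> carrier C" "\<forall>T\<in>I. \<phi> T x = z T" using lift[of z] Z'c by blast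
    then have "x \<in> Z" using z by (auto simp: Z)
    moreover have "q = ?f (B #>\<^bsub>C\<^esub> x)"
    proof (rule extensionalityI[of _ I])
      show "q \<in> extensional I" using q unfolding carr by (simp add: PiE_iff)
    qed (use z x img in simp_all)
    ultimately show "q \<in> ?f ` carrier (C\<lparr>carrier := Z\<rparr> Mod B)"
      using carrQ[of "B #>\<^bsub>C\<^esub> x"] by blast
  qed
  ultimately have "?f \<in> iso (C\<lparr>carrier := Z\<rparr> Mod B) (sum_group I ?Q)"
    by (auto simp: iso_iff hom_def)
  then show ?thesis by (auto simp: is_iso_def)
qed

section \<open>Bredon chain complexes\<close>

lemma face_map: "face j (map f c) = map f (face j c)"
  by (simp add: face_def take_map drop_map)

text \<open>A product over an infinite \<open>S\<close> is one by convention, and \<open>h\<close>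
  preserves one; over finite \<open>S\<close> the claim follows by induction.\<close>

lemma hom_finprod:
  assumes h: "h \<in> hom G H" and G: "comm_group G" and H: "comm_group H"
    and f: "f \<in> S \<rightarrow> carrier G"
  shows "h (finprod G f S) = finprod H (\<lambda>x. h (f x)) S"
proof -
  interpret G: comm_group G by (rule G)
  interpret H: comm_group H by (rule H)
  interpret group_hom G H h by unfold_locales (rule h)
  show ?thesis using f
  proof (induction S rule: infinite_finite_induct)
    case (insert a S)
    then have "(\<lambda>x. h (f x)) \<in> S \<rightarrow> carrier H" "f \<in> S \<rightarrow> carrier G" by (auto simp: Pi_iff)
    moreover have "f a \<in> carrier G" using insert.prems by auto
    ultimately show ?case using insert.IH insert.hyps by simp
  qed simp_all
qed

lemma comm_group_sum_group:
  assumes "\<And>i. i \<in> I \<Longrightarrow> comm_group (A i)"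
  shows "comm_group (sum_group I A)"
proof -
  have g: "\<And>i. i \<in> I \<Longrightarrow> group (A i)" using assms comm_group.axioms(2) by blast
  interpret group "sum_group I A" using g by (rule sum_group)
  show ?thesis
  proof (rule group_comm_groupI)
    fix x y assume "x \<in> carrier (sum_group I A)" "y \<in> carrier (sum_group I A)"
    then have "x i \<otimes>\<^bsub>A i\<^esub> y i = y i \<otimes>\<^bsub>A i\<^esub> x i" if "i \<in> I" for i
      using that g assms[OF that]
      by (auto simp: carrier_sum_group intro!: comm_monoid.m_comm comm_group.axioms(1))
    then show "x \<otimes>\<^bsub>sum_group I A\<^esub> y = y \<otimes>\<^bsub>sum_group I A\<^esub> x" by (auto simp: fun_eq_iff)
  qed
qed

text \<open>These are the local \<open>Z\<close> and \<open>B\<close> of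
  \<open>bredon_homology\<close>, named so that each can be shown to be a subgroup and followed
  under restriction on its own.\<close>

definition bredon_cycles where
  "bredon_cycles K act Y A Mobj Mmap i = (case i of 0 \<Rightarrow> carrier (bredon_chains K act Y A Mobj 0)
    | Suc k \<Rightarrow> kernel (bredon_chains K act Y A Mobj (Suc k)) (bredon_chains K act Y A Mobj k)
        (bredon_bd K act Y A Mobj Mmap k))"

definition bredon_boundaries where
  "bredon_boundaries K act Y A Mobj Mmap i =
    bredon_bd K act Y A Mobj Mmap i ` carrier (bredon_chains K act Y A Mobj (Suc i))"

lemma bredon_homology_eq:
  "bredon_homology K act Y A Mobj Mmap i = (bredon_chains K act Y A Mobj i)
    \<lparr>carrier := bredon_cycles K act Y A Mobj Mmap i\<rparr> Mod bredon_boundaries K act Y A Mobj Mmap i"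
  by (cases i) (simp_all add: bredon_homology_def bredon_cycles_def bredon_boundaries_def Let_def)

lemma mult_chains:
  "x \<otimes>\<^bsub>bredon_chains K act Y A Mobj d\<^esub> y
    = (\<lambda>b\<in>cell_reps K act Y A d. x b \<otimes>\<^bsub>Mobj (stab K act b)\<^esub> y b)"
  by (simp add: bredon_chains_def)

text \<open>\<open>K\<close> acts on the cells, while the coefficients live on the orbit category of the larger group \<open>G\<close>.\<close>
locale bredon_pair = group G
  for G :: "('g, 'm) monoid_scheme" (structure)
  and K :: "('g, 'k) monoid_scheme"
  and act :: "'g \<Rightarrow> 'v \<Rightarrow> 'v"
  and Y A :: "'v list set"
  and F :: "'g set set"
  and Mobj :: "'g set \<Rightarrow> 'b monoid"
  and Mmap :: "'g set \<Rightarrow> 'g set \<Rightarrow> 'g \<Rightarrow> 'b \<Rightarrow> 'b" +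
  assumes bmod: "bredon_module G F Mobj Mmap"
    and K_subgroup: "subgroup (carrier K) G"
    and act_one: "c \<in> Y - A \<Longrightarrow> map (act \<one>) c = c"
    and act_mult: "c \<in> Y - A \<Longrightarrow> g \<in> carrier K \<Longrightarrow> h \<in> carrier K \<Longrightarrow>
      map (act (g \<otimes> h)) c = map (act g) (map (act h) c)"
    and act_closed: "c \<in> Y - A \<Longrightarrow> g \<in> carrier K \<Longrightarrow> map (act g) c \<in> Y - A"
    and stab_in_family: "c \<in> Y - A \<Longrightarrow> stab K act c \<in> F"
begin

declare map_map [simp del]

section \<open>Orbits, representatives and stabilisers\<close>

lemma K_closed [simp]: "g \<in> carrier K \<Longrightarrow> g \<in> carrier G"
  using subgroup.subset[OF K_subgroup] by blast

lemma K_inv [simp]: "g \<in> carrier K \<Longrightarrow> inv g \<in> carrier K"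
  using subgroup.m_inv_closed[OF K_subgroup] by blast

lemma K_mult [simp]: "g \<in> carrier K \<Longrightarrow> h \<in> carrier K \<Longrightarrow> g \<otimes> h \<in> carrier K"
  using subgroup.m_closed[OF K_subgroup] by blast

lemma K_one [simp]: "\<one> \<in> carrier K"
  using subgroup.one_closed[OF K_subgroup] by blast

lemma act_inv: "c \<in> Y - A \<Longrightarrow> g \<in> carrier K \<Longrightarrow> map (act (inv g)) (map (act g) c) = c"
  using act_mult[of c "inv g" g] act_one by simp

lemma orb_translate:
  assumes c: "c \<in> Y - A" and g: "g \<in> carrier K"
  shows "orb K act (map (act g) c) = orb K act c"
proof
  show "orb K act (map (act g) c) \<subseteq> orb K act c"
    using act_mult[OF c] g unfolding orb_def by auto (metis K_mult)
  show "orb K act c \<subseteq> orb K act (map (act g) c)"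
  proof
    fix d assume "d \<in> orb K act c"
    then obtain h where h: "h \<in> carrier K" "d = map (act h) c" by (auto simp: orb_def)
    have "map (act (h \<otimes> inv g)) (map (act g) c) = d"
      using h g act_mult[OF act_closed[OF c g], of h "inv g"] act_inv[OF c g] by (simp del: map_eq_conv)
    then show "d \<in> orb K act (map (act g) c)" unfolding orb_def using h g by (metis (mono_tags, lifting) K_inv K_mult mem_Collect_eq)
  qed
qed

text \<open>The choice made by \<open>orep\<close> depends on the cell only through its orbit as a
  set, so equal orbits have literally the same representative.\<close>

lemma orep_translate: "c \<in> Y - A \<Longrightarrow> g \<in> carrier K \<Longrightarrow> orep K act (map (act g) c) = orep K act c"
  by (simp only: orep_def orb_translate)

lemma orep_ex:
  assumes "c \<in> Y - A"
  shows "\<exists>g\<in>carrier K. orep K act c = map (act g) c"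
proof -
  have "map (act \<one>) c \<in> orb K act c" unfolding orb_def using K_one by blast
  then have "orep K act c \<in> orb K act c" unfolding orep_def by (rule someI)
  then show ?thesis by (auto simp: orb_def)
qed

lemma orep_eqD:
  assumes "c \<in> Y - A" "d \<in> Y - A" "orep K act c = orep K act d"
  shows "\<exists>g\<in>carrier K. d = map (act g) c"
proof -
  obtain g h where gh: "g \<in> carrier K" "h \<in> carrier K" "map (act g) c = map (act h) d"
    using orep_ex[OF assms(1)] orep_ex[OF assms(2)] assms(3) by metis
  then have "d = map (act (inv h)) (map (act g) c)" using act_inv[OF assms(2)] by metis
  then have "d = map (act (inv h \<otimes> g)) c" using act_mult[OF assms(1)] gh by (metis K_inv)
  then show ?thesis using gh by (metis K_inv K_mult)
qed

lemma orep_in: "c \<in> Y - A \<Longrightarrow> orep K act c \<in> Y - A"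
  using orep_ex act_closed by metis

lemma orep_orep: "c \<in> Y - A \<Longrightarrow> orep K act (orep K act c) = orep K act c"
  using orep_ex orep_translate by metis

lemma length_orep: "c \<in> Y - A \<Longrightarrow> length (orep K act c) = length c"
  using orep_ex by fastforce

text \<open>Since \<open>orep\<close> is idempotent, its image consists of its fixed points;
  membership becomes an equation that can be tested on the cell itself.\<close>

lemma cell_reps_iff: "b \<in> cell_reps K act Y A d \<longleftrightarrow> b \<in> rel_cells Y A d \<and> orep K act b = b"
proof
  assume "b \<in> cell_reps K act Y A d"
  then obtain c where "c \<in> Y - A" "length c = Suc d" "b = orep K act c"
    by (auto simp: cell_reps_def rel_cells_def)
  then show "b \<in> rel_cells Y A d \<and> orep K act b = b"
    using orep_in[of c] orep_orep[of c] length_orep[of c] by (auto simp: rel_cells_def)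
next
  assume "b \<in> rel_cells Y A d \<and> orep K act b = b"
  then show "b \<in> cell_reps K act Y A d" unfolding cell_reps_def by (metis imageI)
qed

lemma cell_reps_in: "b \<in> cell_reps K act Y A d \<Longrightarrow> b \<in> Y - A"
  by (simp add: cell_reps_iff rel_cells_def)

lemma subgroup_stab:
  assumes c: "c \<in> Y - A"
  shows "subgroup (stab K act c) G"
proof (rule subgroupI)
  have "\<one> \<in> stab K act c" using act_one[OF c] by (simp add: stab_def)
  then show "stab K act c \<noteq> {}" by blast
  show "stab K act c \<subseteq> carrier G" by (auto simp: stab_def)
next
  fix g assume "g \<in> stab K act c"
  then show "inv g \<in> stab K act c" using act_inv[OF c, of g] by (auto simp: stab_def )
next
  fix g h assume "g \<in> stab K act c" "h \<in> stab K act c"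
  then show "g \<otimes> h \<in> stab K act c" using act_mult[OF c, of g h] by (auto simp: stab_def )
qed

text \<open>The stabiliser of \<open>g b\<close> is \<open>g S_b g^-1\<close>. The inclusion
  obtained is the condition under which \<open>R_g\<close> exists as a map from \<open>G/S_c\<close>
  to \<open>G/S_b\<close>.\<close>

lemma conj_stab:
  assumes b: "b \<in> Y - A" and g: "g \<in> carrier K" and sub: "stab K act c \<subseteq> stab K act (map (act g) b)"
  shows "conj_sub G g (stab K act c) \<subseteq> stab K act b"
proof
  fix u assume "u \<in> conj_sub G g (stab K act c)"
  then obtain k where k: "k \<in> stab K act c" "u = inv g \<otimes> k \<otimes> g" by (auto simp: conj_sub_def)
  then have kk: "k \<in> carrier K" "map (act k) (map (act g) b) = map (act g) b"
    using sub by (auto simp: stab_def)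
  have "map (act (inv g \<otimes> (k \<otimes> g))) b = b"
    using kk g act_mult[OF b, of k g] act_mult[OF b, of "inv g" "k \<otimes> g"] act_inv[OF b g] by (metis K_inv K_mult)
  then show "u \<in> stab K act b" using k kk g by (simp add: stab_def m_assoc)
qed

text \<open>If \<open>g\<close> and \<open>h\<close> carry \<open>b\<close> to the same cell, then
  \<open>g^-1 h\<close> fixes \<open>b\<close>, so \<open>R_g = R_h\<close>. This makes every choice
  of a moving element by \<open>SOME\<close> harmless.\<close>

lemma lcos_stab_eq:
  assumes b: "b \<in> Y - A" and g: "g \<in> carrier K" and h: "h \<in> carrier K"
    and eq: "map (act g) b = map (act h) b"
  shows "g <# stab K act b = h <# stab K act b"
proof (rule l_repr_independence[OF _ _ subgroup_stab[OF b]])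
  have "map (act (inv g \<otimes> h)) b = b"
    using act_mult[OF b, of "inv g" h] eq act_inv[OF b g] g h by (metis K_inv)
  then have "inv g \<otimes> h \<in> stab K act b" using g h by (simp add: stab_def)
  moreover have "h = g \<otimes> (inv g \<otimes> h)" using g h by (simp flip: m_assoc)
  ultimately show "h \<in> g <# stab K act b" unfolding l_coset_def by blast
qed (use g in simp)

text \<open>Stabilising a chain means fixing it vertex by vertex, so every subchain is fixed as
  well.\<close>

lemma stab_face: "stab K act c \<subseteq> stab K act (face j c)"
  by (auto simp: stab_def simp flip: face_map)

section \<open>Coefficient groups and the maps between them\<close>

lemma Mobj_comm_group: "c \<in> Y - A \<Longrightarrow> comm_group (Mobj (stab K act c))"
  using bmod stab_in_family by (simp add: bredon_module_def)

lemma Mobj_group: "c \<in> Y - A \<Longrightarrow> group (Mobj (stab K act c))"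
  using Mobj_comm_group comm_group.axioms(2) by blast

lemma Mmap_hom:
  assumes "c \<in> Y - A" "b \<in> Y - A" "g \<in> carrier K" "stab K act c \<subseteq> stab K act (map (act g) b)"
  shows "Mmap (stab K act c) (stab K act b) g \<in> hom (Mobj (stab K act c)) (Mobj (stab K act b))"
  using bmod stab_in_family assms conj_stab[OF assms(2-4)] by (simp add: bredon_module_def)

lemma Mmap_cong:
  assumes "c \<in> Y - A" "b \<in> Y - A" "g \<in> carrier K" "h \<in> carrier K" "stab K act c \<subseteq> stab K act (map (act g) b)"
    and "map (act g) b = map (act h) b" "x \<in> carrier (Mobj (stab K act c))"
  shows "Mmap (stab K act c) (stab K act b) g x = Mmap (stab K act c) (stab K act b) h x"
  using bmod stab_in_family assms conj_stab[OF assms(2,3,5)] lcos_stab_eq[OF assms(2-4,6)]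
  unfolding bredon_module_def by (metis K_closed)

lemma Mmap_one:
  assumes "c \<in> Y - A" "x \<in> carrier (Mobj (stab K act c))"
  shows "Mmap (stab K act c) (stab K act c) \<one> x = x"
  using bmod stab_in_family assms by (simp add: bredon_module_def)

lemma Mmap_comp:
  assumes "c \<in> Y - A" "b \<in> Y - A" "a \<in> Y - A" "g \<in> carrier K" "h \<in> carrier K"
    and "stab K act c \<subseteq> stab K act (map (act g) b)" "stab K act b \<subseteq> stab K act (map (act h) a)"
    and "x \<in> carrier (Mobj (stab K act c))"
  shows "Mmap (stab K act b) (stab K act a) h (Mmap (stab K act c) (stab K act b) g x)
    = Mmap (stab K act c) (stab K act a) (g \<otimes> h) x"
  using bmod stab_in_family assms conj_stab[OF assms(2,4,6)] conj_stab[OF assms(3,5,7)]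
  unfolding bredon_module_def by (metis K_closed)

section \<open>Chain groups and the differential\<close>

lemma carrier_chains:
  "carrier (bredon_chains K act Y A Mobj d) =
    {x \<in> \<Pi>\<^sub>E b\<in>cell_reps K act Y A d. carrier (Mobj (stab K act b)).
      finite {b \<in> cell_reps K act Y A d. x b \<noteq> \<one>\<^bsub>Mobj (stab K act b)\<^esub>}}"
  unfolding bredon_chains_def by (rule carrier_sum_group) (intro Mobj_group cell_reps_in)

lemma comm_group_chains: "comm_group (bredon_chains K act Y A Mobj d)"
  unfolding bredon_chains_def by (rule comm_group_sum_group) (intro Mobj_comm_group cell_reps_in)

lemma group_chains: "group (bredon_chains K act Y A Mobj d)"
  using comm_group_chains comm_group.axioms(2) by blast

text \<open>This is the part of the index set in \<open>bredon_bd\<close> that does not depend on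
  the chain. The support condition is kept apart, since it changes from chain to chain.\<close>

definition bd_index :: "nat \<Rightarrow> 'v list \<Rightarrow> ('v list \<times> nat) set" where
  "bd_index d b = {(a, j). a \<in> cell_reps K act Y A (Suc d) \<and> j \<le> Suc d \<and>
     face j a \<in> rel_cells Y A d \<and> orep K act (face j a) = b}"

definition bd_term :: "'v list \<Rightarrow> ('v list \<Rightarrow> 'b) \<Rightarrow> 'v list \<times> nat \<Rightarrow> 'b" where
  "bd_term b x = (\<lambda>(a, j). Mmap (stab K act a) (stab K act b)
     (SOME g. g \<in> carrier K \<and> map (act g) b = face j a) (x a) [^]\<^bsub>Mobj (stab K act b)\<^esub> ((-1) ^ j :: int))"

lemma bd_map_ex:
  assumes "b \<in> cell_reps K act Y A d" "(a, j) \<in> bd_index d b"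
  shows "(SOME g. g \<in> carrier K \<and> map (act g) b = face j a) \<in> carrier K
    \<and> map (act (SOME g. g \<in> carrier K \<and> map (act g) b = face j a)) b = face j a"
proof -
  have "b \<in> Y - A" "face j a \<in> Y - A" "orep K act b = orep K act (face j a)"
    using assms by (auto simp: bd_index_def cell_reps_iff rel_cells_def)
  then have "\<exists>g. g \<in> carrier K \<and> map (act g) b = face j a" using orep_eqD by metis
  then show ?thesis by (rule someI_ex)
qed

lemma bd_hom:
  assumes "b \<in> cell_reps K act Y A d" "(a, j) \<in> bd_index d b"
  shows "Mmap (stab K act a) (stab K act b) (SOME g. g \<in> carrier K \<and> map (act g) b = face j a)
    \<in> hom (Mobj (stab K act a)) (Mobj (stab K act b))"
proof (rule Mmap_hom)
  show "a \<in> Y - A" using assms(2) cell_reps_in[of a "Suc d"] by (simp add: bd_index_def)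
  show "b \<in> Y - A" using assms(1) by (rule cell_reps_in)
  show "(SOME g. g \<in> carrier K \<and> map (act g) b = face j a) \<in> carrier K"
    using bd_map_ex[OF assms] by blast
  show "stab K act a \<subseteq> stab K act (map (act (SOME g. g \<in> carrier K \<and> map (act g) b = face j a)) b)"
    unfolding conjunct2[OF bd_map_ex[OF assms]] by (rule stab_face)
qed

lemma chain_in:
  assumes "x \<in> carrier (bredon_chains K act Y A Mobj d)" "b \<in> cell_reps K act Y A d"
  shows "x b \<in> carrier (Mobj (stab K act b))"
  using assms by (auto simp: carrier_chains)

lemma bd_term_closed:
  assumes b: "b \<in> cell_reps K act Y A d" and p: "p \<in> bd_index d b"
    and x: "x \<in> carrier (bredon_chains K act Y A Mobj (Suc d))"
  shows "bd_term b x p \<in> carrier (Mobj (stab K act b))"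
proof -
  obtain a j where [simp]: "p = (a, j)" by force
  have "x a \<in> carrier (Mobj (stab K act a))" using p x by (auto simp: bd_index_def intro: chain_in)
  then show ?thesis using bd_hom[OF b p[simplified]]
    by (auto simp: bd_term_def hom_def intro!: group.int_pow_closed Mobj_group cell_reps_in[OF b])
qed

lemma bd_term_one:
  assumes b: "b \<in> cell_reps K act Y A d" and p: "(a, j) \<in> bd_index d b"
    and x: "x a = \<one>\<^bsub>Mobj (stab K act a)\<^esub>"
  shows "bd_term b x (a, j) = \<one>\<^bsub>Mobj (stab K act b)\<^esub>"
proof -
  have a: "a \<in> Y - A" using p cell_reps_in[of a "Suc d"] by (simp add: bd_index_def)
  show ?thesis using hom_one[OF bd_hom[OF b p]] Mobj_group a cell_reps_in[OF b] x
    by (simp add: bd_term_def group.int_pow_one)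
qed

lemma bd_term_mult:
  assumes b: "b \<in> cell_reps K act Y A d" and p: "p \<in> bd_index d b"
    and x: "x \<in> carrier (bredon_chains K act Y A Mobj (Suc d))"
    and y: "y \<in> carrier (bredon_chains K act Y A Mobj (Suc d))"
  shows "bd_term b (x \<otimes>\<^bsub>bredon_chains K act Y A Mobj (Suc d)\<^esub> y) p
    = bd_term b x p \<otimes>\<^bsub>Mobj (stab K act b)\<^esub> bd_term b y p"
proof -
  obtain a j where [simp]: "p = (a, j)" by force
  have a: "a \<in> cell_reps K act Y A (Suc d)" using p by (auto simp: bd_index_def)
  note h = bd_hom[OF b p[simplified]]
  have xy: "x a \<in> carrier (Mobj (stab K act a))" "y a \<in> carrier (Mobj (stab K act a))"
    using a x y by (auto intro: chain_in)
  have "(x \<otimes>\<^bsub>bredon_chains K act Y A Mobj (Suc d)\<^esub> y) a = x a \<otimes>\<^bsub>Mobj (stab K act a)\<^esub> y a"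
    using a by (simp add: bredon_chains_def)
  then show ?thesis
    using xy h by (simp add: bd_term_def hom_mult hom_in_carrier
        comm_group.int_pow_distrib[OF Mobj_comm_group[OF cell_reps_in[OF b]]])
qed

lemma bd_apply_aux:
  "b \<in> cell_reps K act Y A d \<Longrightarrow> bredon_bd K act Y A Mobj Mmap d x b =
    finprod (Mobj (stab K act b)) (bd_term b x) {p \<in> bd_index d b. x (fst p) \<noteq> \<one>\<^bsub>Mobj (stab K act (fst p))\<^esub>}"
proof -
  assume b: "b \<in> cell_reps K act Y A d"
  have "{(a, j). a \<in> cell_reps K act Y A (Suc d) \<and> x a \<noteq> \<one>\<^bsub>Mobj (stab K act a)\<^esub> \<and>
      j \<le> Suc d \<and> face j a \<in> rel_cells Y A d \<and> orep K act (face j a) = b}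
    = {p \<in> bd_index d b. x (fst p) \<noteq> \<one>\<^bsub>Mobj (stab K act (fst p))\<^esub>}"
    by (auto simp: bd_index_def)
  then show ?thesis using b by (simp only: bredon_bd_def bd_term_def restrict_apply')
qed

text \<open>There are finitely many cells in the support, each with at most \<open>d + 2\<close>
  faces. The set collects the pairs for all \<open>b\<close> at once, which also bounds the support
  of the image.\<close>

lemma finite_bd_support:
  assumes "x \<in> carrier (bredon_chains K act Y A Mobj (Suc d))"
  shows "finite {p. \<exists>b. p \<in> bd_index d b \<and> x (fst p) \<noteq> \<one>\<^bsub>Mobj (stab K act (fst p))\<^esub>}"
proof (rule finite_subset)
  show "finite ({a \<in> cell_reps K act Y A (Suc d). x a \<noteq> \<one>\<^bsub>Mobj (stab K act a)\<^esub>} \<times> {..Suc d})"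
    using assms by (simp add: carrier_chains)
qed (auto simp: bd_index_def)

text \<open>Terms outside the support are one, so the product may be taken over any larger finite
  index set. Additivity needs this, since the supports of \<open>x\<close>, \<open>y\<close> and
  their product differ.\<close>

lemma bd_apply:
  assumes b: "b \<in> cell_reps K act Y A d" and x: "x \<in> carrier (bredon_chains K act Y A Mobj (Suc d))"
    and S: "finite S" "S \<subseteq> bd_index d b"
      "{p \<in> bd_index d b. x (fst p) \<noteq> \<one>\<^bsub>Mobj (stab K act (fst p))\<^esub>} \<subseteq> S"
  shows "bredon_bd K act Y A Mobj Mmap d x b = finprod (Mobj (stab K act b)) (bd_term b x) S"
proof -
  interpret M: comm_group "Mobj (stab K act b)" using Mobj_comm_group cell_reps_in[OF b] .
  show ?thesis unfolding bd_apply_aux[OF b]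
  proof (rule M.finprod_mono_neutral_cong_left[OF S(1,3)])
    fix p assume "p \<in> S - {p \<in> bd_index d b. x (fst p) \<noteq> \<one>\<^bsub>Mobj (stab K act (fst p))\<^esub>}"
    then show "bd_term b x p = \<one>\<^bsub>Mobj (stab K act b)\<^esub>"
      using bd_term_one[OF b, of "fst p" "snd p" x] S(2) by auto
  qed (use bd_term_closed[OF b _ x] S(2) in auto)
qed

lemma bredon_bd_hom:
  "bredon_bd K act Y A Mobj Mmap d \<in>
    hom (bredon_chains K act Y A Mobj (Suc d)) (bredon_chains K act Y A Mobj d)"
proof (rule homI)
  fix x assume x: "x \<in> carrier (bredon_chains K act Y A Mobj (Suc d))"
  have "bredon_bd K act Y A Mobj Mmap d x b \<in> carrier (Mobj (stab K act b))"
    if b: "b \<in> cell_reps K act Y A d" for b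
    unfolding bd_apply_aux[OF b]
    by (rule comm_monoid.finprod_closed[OF comm_group.axioms(1)[OF Mobj_comm_group[OF cell_reps_in[OF b]]]])
      (use bd_term_closed[OF b _ x] in auto)
  moreover have "finite {b \<in> cell_reps K act Y A d. bredon_bd K act Y A Mobj Mmap d x b \<noteq> \<one>\<^bsub>Mobj (stab K act b)\<^esub>}"
  proof (rule finite_subset)
    \<comment> \<open>A nontrivial component at \<open>b\<close> requires a cell of the support with
      a face in the orbit of \<open>b\<close>; so the support of the image is covered by the
      representatives of finitely many faces.\<close>
    let ?S = "{p. \<exists>b. p \<in> bd_index d b \<and> x (fst p) \<noteq> \<one>\<^bsub>Mobj (stab K act (fst p))\<^esub>}"
    show "finite ((\<lambda>(a, j). orep K act (face j a)) ` ?S)" using finite_bd_support[OF x] by blast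
    show "{b \<in> cell_reps K act Y A d. bredon_bd K act Y A Mobj Mmap d x b \<noteq> \<one>\<^bsub>Mobj (stab K act b)\<^esub>}
      \<subseteq> (\<lambda>(a, j). orep K act (face j a)) ` ?S"
    proof clarify
      fix b assume b: "b \<in> cell_reps K act Y A d" and ne: "bredon_bd K act Y A Mobj Mmap d x b \<noteq> \<one>\<^bsub>Mobj (stab K act b)\<^esub>"
      interpret M: comm_group "Mobj (stab K act b)" using Mobj_comm_group cell_reps_in[OF b] .
      have "{p \<in> bd_index d b. x (fst p) \<noteq> \<one>\<^bsub>Mobj (stab K act (fst p))\<^esub>} \<noteq> {}"
      proof
        assume e: "{p \<in> bd_index d b. x (fst p) \<noteq> \<one>\<^bsub>Mobj (stab K act (fst p))\<^esub>} = {}"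
        show False using ne unfolding bd_apply_aux[OF b] e by simp
      qed
      then obtain a j where "(a, j) \<in> bd_index d b" "x a \<noteq> \<one>\<^bsub>Mobj (stab K act a)\<^esub>" by auto
      then show "b \<in> (\<lambda>(a, j). orep K act (face j a)) ` ?S"
        by (intro image_eqI[of _ _ "(a, j)"]) (auto simp: bd_index_def)
    qed
  qed
  ultimately show "bredon_bd K act Y A Mobj Mmap d x \<in> carrier (bredon_chains K act Y A Mobj d)"
    unfolding carrier_chains by (auto simp: bredon_bd_def)
next
  fix x y assume x: "x \<in> carrier (bredon_chains K act Y A Mobj (Suc d))"
    and y: "y \<in> carrier (bredon_chains K act Y A Mobj (Suc d))"
  let ?xy = "x \<otimes>\<^bsub>bredon_chains K act Y A Mobj (Suc d)\<^esub> y"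
  have xy: "?xy \<in> carrier (bredon_chains K act Y A Mobj (Suc d))"
    by (rule monoid.m_closed[OF group.is_monoid[OF group_chains] x y])
  have "bredon_bd K act Y A Mobj Mmap d ?xy b
      = bredon_bd K act Y A Mobj Mmap d x b \<otimes>\<^bsub>Mobj (stab K act b)\<^esub> bredon_bd K act Y A Mobj Mmap d y b"
    if b: "b \<in> cell_reps K act Y A d" for b
  proof -
    interpret M: comm_group "Mobj (stab K act b)" using Mobj_comm_group cell_reps_in[OF b] .
    \<comment> \<open>A common finite index set for three products that originally range over three
      different supports.\<close>
    define S where "S = {p \<in> bd_index d b. x (fst p) \<noteq> \<one>\<^bsub>Mobj (stab K act (fst p))\<^esub>}
      \<union> {p \<in> bd_index d b. y (fst p) \<noteq> \<one>\<^bsub>Mobj (stab K act (fst p))\<^esub>}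
      \<union> {p \<in> bd_index d b. ?xy (fst p) \<noteq> \<one>\<^bsub>Mobj (stab K act (fst p))\<^esub>}"
    have "finite {p \<in> bd_index d b. z (fst p) \<noteq> \<one>\<^bsub>Mobj (stab K act (fst p))\<^esub>}"
      if "z \<in> carrier (bredon_chains K act Y A Mobj (Suc d))" for z
      by (rule finite_subset[OF _ finite_bd_support[OF that]]) blast
    then have fin: "finite S" unfolding S_def using x y xy by blast
    have sub: "S \<subseteq> bd_index d b" by (auto simp: S_def)
    have "bredon_bd K act Y A Mobj Mmap d ?xy b = finprod (Mobj (stab K act b)) (bd_term b ?xy) S"
      by (rule bd_apply[OF b xy fin sub]) (auto simp: S_def)
    also have "\<dots> = finprod (Mobj (stab K act b)) (\<lambda>p. bd_term b x p \<otimes>\<^bsub>Mobj (stab K act b)\<^esub> bd_term b y p) S"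
      using sub bd_term_mult[OF b _ x y] bd_term_closed[OF b _ x] bd_term_closed[OF b _ y]
      by (intro M.finprod_cong') (auto simp: subset_iff)
    also have "\<dots> = finprod (Mobj (stab K act b)) (bd_term b x) S
        \<otimes>\<^bsub>Mobj (stab K act b)\<^esub> finprod (Mobj (stab K act b)) (bd_term b y) S"
      using sub bd_term_closed[OF b _ x] bd_term_closed[OF b _ y] by (intro M.finprod_multf) auto
    also have "finprod (Mobj (stab K act b)) (bd_term b x) S = bredon_bd K act Y A Mobj Mmap d x b"
      by (rule bd_apply[OF b x fin sub, symmetric]) (auto simp: S_def)
    also have "finprod (Mobj (stab K act b)) (bd_term b y) S = bredon_bd K act Y A Mobj Mmap d y b"
      by (rule bd_apply[OF b y fin sub, symmetric]) (auto simp: S_def)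
    finally show ?thesis .
  qed
  then show "bredon_bd K act Y A Mobj Mmap d ?xy
      = bredon_bd K act Y A Mobj Mmap d x \<otimes>\<^bsub>bredon_chains K act Y A Mobj d\<^esub> bredon_bd K act Y A Mobj Mmap d y"
    unfolding mult_chains[where d = d]
    by (intro extensionalityI[of _ "cell_reps K act Y A d"]) (simp_all add: bredon_bd_def)
qed

lemma group_hom_bd:
  "group_hom (bredon_chains K act Y A Mobj (Suc d)) (bredon_chains K act Y A Mobj d) (bredon_bd K act Y A Mobj Mmap d)"
  by (simp add: group_hom_def group_hom_axioms_def bredon_bd_hom group_chains)

lemma subgroup_cycles: "subgroup (bredon_cycles K act Y A Mobj Mmap i) (bredon_chains K act Y A Mobj i)"
  by (cases i) (simp_all add: bredon_cycles_def group_hom.subgroup_kernel[OF group_hom_bd]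
      group.subgroup_self[OF group_chains])

lemma subgroup_boundaries: "subgroup (bredon_boundaries K act Y A Mobj Mmap i) (bredon_chains K act Y A Mobj i)"
  unfolding bredon_boundaries_def
  by (intro group_hom.subgroup_img_is_subgroup[OF group_hom_bd] group.subgroup_self group_chains)

end

section \<open>Induced families of cells\<close>

text \<open>As a \<open>G\<close>-set, \<open>Y - A\<close> is the disjoint union over
  \<open>T\<close> of the induced sets, i.e. of the balanced products of \<open>G\<close> with
  \<open>Y' T - A' T\<close> over \<open>H T\<close>: \<open>meets\<close> says that the translates
  of the pieces cover everything, \<open>separated\<close> that they overlap only as
  \<open>H T\<close> forces. \<open>sub_face\<close> keeps the differential inside one
  piece.\<close>

locale induced_cells = bredon_pair G G act Y A F Mobj Mmap
  for G :: "('g, 'm) monoid_scheme" (structure)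
  and act :: "'g \<Rightarrow> 'v \<Rightarrow> 'v"
  and Y A :: "'v list set"
  and F :: "'g set set"
  and Mobj :: "'g set \<Rightarrow> 'b monoid"
  and Mmap :: "'g set \<Rightarrow> 'g set \<Rightarrow> 'g \<Rightarrow> 'b \<Rightarrow> 'b" +
  fixes I :: "'t set" and H :: "'t \<Rightarrow> ('g, 'h) monoid_scheme"
    and Y' A' :: "'t \<Rightarrow> 'v list set"
  assumes finite_I: "finite I"
    and H_subgroup: "T \<in> I \<Longrightarrow> subgroup (carrier (H T)) G"
    and sub_cells: "T \<in> I \<Longrightarrow> c \<in> Y' T - A' T \<Longrightarrow> c \<in> Y - A"
    and sub_closed: "T \<in> I \<Longrightarrow> c \<in> Y' T - A' T \<Longrightarrow> g \<in> carrier (H T) \<Longrightarrow> map (act g) c \<in> Y' T - A' T"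
    and meets: "c \<in> Y - A \<Longrightarrow> \<exists>T\<in>I. \<exists>g\<in>carrier G. map (act g) c \<in> Y' T - A' T"
    and separated: "T \<in> I \<Longrightarrow> U \<in> I \<Longrightarrow> c \<in> Y' T - A' T \<Longrightarrow> g \<in> carrier G \<Longrightarrow>
      map (act g) c \<in> Y' U - A' U \<Longrightarrow> U = T \<and> g \<in> carrier (H T)"
    and sub_face: "T \<in> I \<Longrightarrow> c \<in> Y' T - A' T \<Longrightarrow> face j c \<in> Y - A \<Longrightarrow> face j c \<in> Y' T - A' T"
begin

lemma H_closed: "T \<in> I \<Longrightarrow> g \<in> carrier (H T) \<Longrightarrow> g \<in> carrier G"
  using subgroup.subset[OF H_subgroup] by blast

text \<open>An element of \<open>G\<close> that fixes \<open>c\<close> maps a cell of the piece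
  \<open>T\<close> into that piece, so \<open>separated\<close> places it in
  \<open>H T\<close>.\<close>

lemma stab_sub:
  assumes T: "T \<in> I" and c: "c \<in> Y' T - A' T"
  shows "stab (H T) act c = stab G act c"
proof
  show "stab (H T) act c \<subseteq> stab G act c" using H_closed[OF T] by (auto simp: stab_def)
  show "stab G act c \<subseteq> stab (H T) act c"
  proof
    fix g assume "g \<in> stab G act c"
    then have g: "g \<in> carrier G" "map (act g) c = c" by (simp_all add: stab_def)
    then have "g \<in> carrier (H T)" using separated[OF T T c, of g] c by simp
    with g show "g \<in> stab (H T) act c" by (simp add: stab_def)
  qed
qed

lemma bredon_pair_sub:
  assumes T: "T \<in> I"
  shows "bredon_pair G (H T) act (Y' T) (A' T) F Mobj Mmap"
proof (intro bredon_pair.intro bredon_pair_axioms.intro)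
  show "group G" by (rule is_group)
  show "bredon_module G F Mobj Mmap" by (rule bmod)
  show "subgroup (carrier (H T)) G" by (rule H_subgroup[OF T])
next
  fix c assume c: "c \<in> Y' T - A' T"
  note c' = sub_cells[OF T c]
  show "map (act \<one>) c = c" by (rule act_one[OF c'])
  show "stab (H T) act c \<in> F" using stab_in_family[OF c'] stab_sub[OF T c] by simp
  fix g assume g: "g \<in> carrier (H T)"
  show "map (act g) c \<in> Y' T - A' T" by (rule sub_closed[OF T c g])
  fix h assume h: "h \<in> carrier (H T)"
  show "map (act (g \<otimes> h)) c = map (act g) (map (act h) c)"
    by (rule act_mult[OF c' H_closed[OF T g] H_closed[OF T h]])
qed

section \<open>Local and global orbit representatives\<close>

abbreviation rep :: "'v list \<Rightarrow> 'v list" where "rep \<equiv> orep G act"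
abbreviation reps :: "'t \<Rightarrow> nat \<Rightarrow> 'v list set" where
  "reps T d \<equiv> cell_reps (H T) act (Y' T) (A' T) d"

lemma reps_sub: "T \<in> I \<Longrightarrow> b \<in> reps T d \<Longrightarrow> b \<in> Y' T - A' T"
  using bredon_pair.cell_reps_in[OF bredon_pair_sub] by blast

lemma reps_in: "T \<in> I \<Longrightarrow> b \<in> reps T d \<Longrightarrow> b \<in> Y - A"
  by (rule sub_cells[OF _ reps_sub])

lemma stab_reps: "T \<in> I \<Longrightarrow> b \<in> reps T d \<Longrightarrow> stab (H T) act b = stab G act b"
  by (rule stab_sub[OF _ reps_sub])

lemma rep_reps:
  assumes T: "T \<in> I" and b: "b \<in> reps T d"
  shows "rep b \<in> cell_reps G act Y A d"
proof -
  have "length b = Suc d" using b bredon_pair.cell_reps_iff[OF bredon_pair_sub[OF T]] by (simp add: rel_cells_def)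
  then show ?thesis using orep_in[OF reps_in[OF T b]] orep_orep[OF reps_in[OF T b]] length_orep[OF reps_in[OF T b]]
    by (simp add: cell_reps_iff rel_cells_def)
qed

lemma rep_eq_imp:
  assumes T: "T \<in> I" and U: "U \<in> I" and b: "b \<in> Y' T - A' T" and c: "c \<in> Y' U - A' U" and eq: "rep b = rep c"
  shows "U = T \<and> orep (H T) act b = orep (H T) act c"
proof -
  obtain g where g: "g \<in> carrier G" "c = map (act g) b"
    using orep_eqD[OF sub_cells[OF T b] sub_cells[OF U c] eq] by blast
  then have "U = T" "g \<in> carrier (H T)" using separated[OF T U b, of g] c by auto
  then show ?thesis using g bredon_pair.orep_translate[OF bredon_pair_sub[OF T] b] by simp
qed

text \<open>With \<open>rep_surj\<close> this makes \<open>rep\<close> a bijection from the disjoint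
  union of the local representatives onto the global ones. It is in general not the identity, since
  the two choices are independent.\<close>

lemma rep_inj:
  assumes T: "T \<in> I" and U: "U \<in> I" and b: "b \<in> reps T d" and c: "c \<in> reps U e" and eq: "rep b = rep c"
  shows "U = T \<and> c = b"
  using rep_eq_imp[OF T U reps_sub[OF T b] reps_sub[OF U c] eq] b c
    bredon_pair.cell_reps_iff[OF bredon_pair_sub[OF T]] by auto

lemma rep_surj:
  assumes a: "a \<in> cell_reps G act Y A d"
  shows "\<exists>T\<in>I. \<exists>b\<in>reps T d. rep b = a"
proof -
  have aY: "a \<in> Y - A" "length a = Suc d" "rep a = a" using a by (simp_all add: cell_reps_iff rel_cells_def)
  obtain T g where T: "T \<in> I" and g: "g \<in> carrier G" "map (act g) a \<in> Y' T - A' T" using meets[OF aY(1)] by blast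
  interpret T: bredon_pair G "H T" act "Y' T" "A' T" F Mobj Mmap by (rule bredon_pair_sub[OF T])
  let ?b = "orep (H T) act (map (act g) a)"
  have b: "?b \<in> reps T d" using T.orep_in[OF g(2)] T.orep_orep[OF g(2)] T.length_orep[OF g(2)] aY(2)
    by (simp add: T.cell_reps_iff rel_cells_def)
  obtain h where h: "h \<in> carrier (H T)" "?b = map (act h) (map (act g) a)" using T.orep_ex[OF g(2)] by blast
  have "rep ?b = a"
    unfolding h(2) orep_translate[OF sub_cells[OF T g(2)] H_closed[OF T h(1)]] orep_translate[OF aY(1) g(1)] by (rule aY(3))
  then show ?thesis using T b by blast
qed

section \<open>Transport of coefficients along a change of representative\<close>

definition mover :: "'v list \<Rightarrow> 'g" where
  "mover b = (SOME g. g \<in> carrier G \<and> map (act g) b = rep b)"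

lemma mover:
  assumes "b \<in> Y - A"
  shows "mover b \<in> carrier G" "map (act (mover b)) b = rep b"
proof -
  have "\<exists>g. g \<in> carrier G \<and> map (act g) b = rep b" using orep_ex[OF assms] by metis
  then have "mover b \<in> carrier G \<and> map (act (mover b)) b = rep b" unfolding mover_def by (rule someI_ex)
  then show "mover b \<in> carrier G" "map (act (mover b)) b = rep b" by blast+
qed

text \<open>Since \<open>rep b = g b\<close> for \<open>g = mover b\<close>, the stabiliser of
  \<open>rep b\<close> is \<open>g S_b g^-1\<close>, so \<open>R_g\<close> leads from
  \<open>G/S_(rep b)\<close> to \<open>G/S_b\<close>. The transport therefore runs from global to
  local coefficients.\<close>

definition transfer :: "'v list \<Rightarrow> 'b \<Rightarrow> 'b" where
  "transfer b = Mmap (stab G act (rep b)) (stab G act b) (mover b)"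

lemma transfer_hom:
  assumes b: "b \<in> Y - A"
  shows "transfer b \<in> hom (Mobj (stab G act (rep b))) (Mobj (stab G act b))"
  unfolding transfer_def using Mmap_hom[OF orep_in[OF b] b mover(1)[OF b]] mover(2)[OF b] by simp

text \<open>The inverse is induced by the inverse of the mover: by functoriality both composites are
  \<open>M(R_1)\<close>, the identity.\<close>

lemma transfer_bij:
  assumes b: "b \<in> Y - A"
  shows "bij_betw (transfer b) (carrier (Mobj (stab G act (rep b)))) (carrier (Mobj (stab G act b)))"
proof -
  note r = orep_in[OF b] and m = mover[OF b]
  let ?s = "Mmap (stab G act b) (stab G act (rep b)) (inv (mover b))"
  have inv: "map (act (inv (mover b))) (rep b) = b" using act_inv[OF b m(1)] m(2) by simp
  have s: "?s \<in> hom (Mobj (stab G act b)) (Mobj (stab G act (rep b)))"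
    using Mmap_hom[OF b r, of "inv (mover b)"] m(1) inv by simp
  show ?thesis
  proof (rule bij_betw_byWitness[where f' = ?s])
    show "\<forall>x\<in>carrier (Mobj (stab G act (rep b))). ?s (transfer b x) = x"
      unfolding transfer_def using Mmap_comp[OF r b r m(1), of "inv (mover b)"] m inv Mmap_one[OF r] by simp
    show "\<forall>x\<in>carrier (Mobj (stab G act b)). transfer b (?s x) = x"
      unfolding transfer_def using Mmap_comp[OF b r b, of "inv (mover b)" "mover b"] m inv Mmap_one[OF b] by simp
    show "transfer b ` carrier (Mobj (stab G act (rep b))) \<subseteq> carrier (Mobj (stab G act b))"
      using transfer_hom[OF b] by (auto simp: hom_def)
    show "?s ` carrier (Mobj (stab G act b)) \<subseteq> carrier (Mobj (stab G act (rep b)))"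
      using s by (auto simp: hom_def)
  qed
qed

lemma transfer_one: "b \<in> Y - A \<Longrightarrow> transfer b \<one>\<^bsub>Mobj (stab G act (rep b))\<^esub> = \<one>\<^bsub>Mobj (stab G act b)\<^esub>"
  by (rule hom_one[OF transfer_hom Mobj_group[OF orep_in] Mobj_group])

lemma transfer_eq_one_iff:
  assumes b: "b \<in> Y - A" and x: "x \<in> carrier (Mobj (stab G act (rep b)))"
  shows "transfer b x = \<one>\<^bsub>Mobj (stab G act b)\<^esub> \<longleftrightarrow> x = \<one>\<^bsub>Mobj (stab G act (rep b))\<^esub>"
proof -
  have "\<one>\<^bsub>Mobj (stab G act (rep b))\<^esub> \<in> carrier (Mobj (stab G act (rep b)))"
    using Mobj_group[OF orep_in[OF b]] by (simp add: group.is_monoid)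
  then show ?thesis
    using transfer_one[OF b] bij_betw_imp_inj_on[OF transfer_bij[OF b]] x by (metis inj_onD)
qed

section \<open>The isomorphism of chain groups\<close>

definition restr :: "'t \<Rightarrow> nat \<Rightarrow> ('v list \<Rightarrow> 'b) \<Rightarrow> 'v list \<Rightarrow> 'b" where
  "restr T d x = (\<lambda>b\<in>reps T d. transfer b (x (rep b)))"

lemma carrier_sub_chains:
  assumes T: "T \<in> I"
  shows "x \<in> carrier (bredon_chains (H T) act (Y' T) (A' T) Mobj d) \<longleftrightarrow>
    x \<in> (\<Pi>\<^sub>E b\<in>reps T d. carrier (Mobj (stab G act b))) \<and>
    finite {b \<in> reps T d. x b \<noteq> \<one>\<^bsub>Mobj (stab G act b)\<^esub>}"
proof -
  have "{b \<in> reps T d. x b \<noteq> \<one>\<^bsub>Mobj (stab (H T) act b)\<^esub>} = {b \<in> reps T d. x b \<noteq> \<one>\<^bsub>Mobj (stab G act b)\<^esub>}"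
    by (rule Collect_cong) (use stab_reps[OF T] in auto)
  moreover have "(\<Pi>\<^sub>E b\<in>reps T d. carrier (Mobj (stab (H T) act b))) = (\<Pi>\<^sub>E b\<in>reps T d. carrier (Mobj (stab G act b)))"
    by (rule PiE_cong) (simp add: stab_reps[OF T])
  ultimately show ?thesis by (simp add: bredon_pair.carrier_chains[OF bredon_pair_sub[OF T]])
qed

lemma restr_hom:
  assumes T: "T \<in> I"
  shows "restr T d \<in> hom (bredon_chains G act Y A Mobj d) (bredon_chains (H T) act (Y' T) (A' T) Mobj d)"
proof (rule homI)
  fix x assume x: "x \<in> carrier (bredon_chains G act Y A Mobj d)"
  have xr: "x (rep b) \<in> carrier (Mobj (stab G act (rep b)))" if "b \<in> reps T d" for b
    by (rule chain_in[OF x rep_reps[OF T that]])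
  have "restr T d x \<in> (\<Pi>\<^sub>E b\<in>reps T d. carrier (Mobj (stab G act b)))"
    unfolding restr_def
    by (rule restrict_PiE_iff[THEN iffD2]) (use hom_in_carrier[OF transfer_hom[OF reps_in[OF T]] xr] in blast)
  \<comment> \<open>\<open>rep\<close> embeds the support of the restriction into the finite support
    of \<open>x\<close>.\<close>
  moreover have "finite {b \<in> reps T d. restr T d x b \<noteq> \<one>\<^bsub>Mobj (stab G act b)\<^esub>}"
  proof (rule finite_imageD[of rep])
    have "rep ` {b \<in> reps T d. restr T d x b \<noteq> \<one>\<^bsub>Mobj (stab G act b)\<^esub>}
      \<subseteq> {a \<in> cell_reps G act Y A d. x a \<noteq> \<one>\<^bsub>Mobj (stab G act a)\<^esub>}"
      using rep_reps[OF T] transfer_one[OF reps_in[OF T]] by (auto simp: restr_def)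
    moreover have "finite {a \<in> cell_reps G act Y A d. x a \<noteq> \<one>\<^bsub>Mobj (stab G act a)\<^esub>}"
      using x by (simp add: carrier_chains)
    ultimately show "finite (rep ` {b \<in> reps T d. restr T d x b \<noteq> \<one>\<^bsub>Mobj (stab G act b)\<^esub>})"
      by (rule finite_subset)
    show "inj_on rep {b \<in> reps T d. restr T d x b \<noteq> \<one>\<^bsub>Mobj (stab G act b)\<^esub>}"
      using rep_inj[OF T T] by (auto intro!: inj_onI)
  qed
  ultimately show "restr T d x \<in> carrier (bredon_chains (H T) act (Y' T) (A' T) Mobj d)"
    by (simp add: carrier_sub_chains[OF T])
next
  fix x y assume x: "x \<in> carrier (bredon_chains G act Y A Mobj d)" and y: "y \<in> carrier (bredon_chains G act Y A Mobj d)"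
  have "transfer b ((x \<otimes>\<^bsub>bredon_chains G act Y A Mobj d\<^esub> y) (rep b))
      = transfer b (x (rep b)) \<otimes>\<^bsub>Mobj (stab (H T) act b)\<^esub> transfer b (y (rep b))" if b: "b \<in> reps T d" for b
    using rep_reps[OF T b] hom_mult[OF transfer_hom[OF reps_in[OF T b]] chain_in[OF x rep_reps[OF T b]] chain_in[OF y rep_reps[OF T b]]]
    by (simp add: mult_chains stab_reps[OF T b])
  then show "restr T d (x \<otimes>\<^bsub>bredon_chains G act Y A Mobj d\<^esub> y)
      = restr T d x \<otimes>\<^bsub>bredon_chains (H T) act (Y' T) (A' T) Mobj d\<^esub> restr T d y"
    unfolding mult_chains[where K = "H T"]
    by (intro extensionalityI[of _ "reps T d"]) (simp_all add: restr_def)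
qed

lemma restr_bij:
  "bij_betw (\<lambda>x. \<lambda>T\<in>I. restr T d x) (carrier (bredon_chains G act Y A Mobj d))
    (\<Pi>\<^sub>E T\<in>I. carrier (bredon_chains (H T) act (Y' T) (A' T) Mobj d))"
proof (rule bij_betw_imageI)
  show "inj_on (\<lambda>x. \<lambda>T\<in>I. restr T d x) (carrier (bredon_chains G act Y A Mobj d))"
  proof (rule inj_onI)
    fix x y assume x: "x \<in> carrier (bredon_chains G act Y A Mobj d)" and y: "y \<in> carrier (bredon_chains G act Y A Mobj d)"
      and eq: "(\<lambda>T\<in>I. restr T d x) = (\<lambda>T\<in>I. restr T d y)"
    show "x = y"
    proof (rule extensionalityI)
      show "x \<in> extensional (cell_reps G act Y A d)" "y \<in> extensional (cell_reps G act Y A d)"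
        using x y by (simp_all add: carrier_chains PiE_iff)
      fix a assume a: "a \<in> cell_reps G act Y A d"
      obtain T b where T: "T \<in> I" and b: "b \<in> reps T d" "rep b = a" using rep_surj[OF a] by blast
      have "restr T d x b = restr T d y b" using fun_cong[OF eq, of T] T by simp
      then have "transfer b (x (rep b)) = transfer b (y (rep b))" using b by (simp add: restr_def)
      then have "x (rep b) = y (rep b)"
        by (rule inj_onD[OF bij_betw_imp_inj_on[OF transfer_bij[OF reps_in[OF T b(1)]]]])
          (use chain_in[OF x a] chain_in[OF y a] b(2) in simp_all)
      then show "x a = y a" using b by simp
    qed
  qed
  show "(\<lambda>x. \<lambda>T\<in>I. restr T d x) ` carrier (bredon_chains G act Y A Mobj d)
      = (\<Pi>\<^sub>E T\<in>I. carrier (bredon_chains (H T) act (Y' T) (A' T) Mobj d))"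
  proof (intro subset_antisym image_subsetI subsetI)
    fix x assume x: "x \<in> carrier (bredon_chains G act Y A Mobj d)"
    show "(\<lambda>T\<in>I. restr T d x) \<in> (\<Pi>\<^sub>E T\<in>I. carrier (bredon_chains (H T) act (Y' T) (A' T) Mobj d))"
      using hom_in_carrier[OF restr_hom x] by (simp add: restrict_PiE_iff)
  next
    fix y assume y: "y \<in> (\<Pi>\<^sub>E T\<in>I. carrier (bredon_chains (H T) act (Y' T) (A' T) Mobj d))"
    \<comment> \<open>The inverse of \<open>(T, b) \<mapsto> rep b\<close>; by
      \<open>rep_inj\<close> the choice is forced, which \<open>pick_rep\<close> records.\<close>
    define pick where "pick a = (SOME p. fst p \<in> I \<and> snd p \<in> reps (fst p) d \<and> rep (snd p) = a)" for a
    have pick_rep: "pick (rep b) = (T, b)" if T: "T \<in> I" and b: "b \<in> reps T d" for T b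
    proof -
      have "fst (pick (rep b)) \<in> I \<and> snd (pick (rep b)) \<in> reps (fst (pick (rep b))) d \<and> rep (snd (pick (rep b))) = rep b"
        unfolding pick_def by (rule someI[of _ "(T, b)"]) (simp add: T b)
      then show ?thesis using rep_inj[OF T _ b, of "fst (pick (rep b))" "snd (pick (rep b))" d] by (simp add: prod_eq_iff)
    qed
    have ym: "y T b \<in> carrier (Mobj (stab G act b))" if T: "T \<in> I" and b: "b \<in> reps T d" for T b
      using y T b carrier_sub_chains[OF T] by (auto simp: PiE_iff)
    define x where "x = (\<lambda>a\<in>cell_reps G act Y A d.
      inv_into (carrier (Mobj (stab G act a))) (transfer (snd (pick a))) (y (fst (pick a)) (snd (pick a))))"
    have xr: "x (rep b) \<in> carrier (Mobj (stab G act (rep b))) \<and> transfer b (x (rep b)) = y T b"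
      if T: "T \<in> I" and b: "b \<in> reps T d" for T b
    proof -
      have e: "x (rep b) = inv_into (carrier (Mobj (stab G act (rep b)))) (transfer b) (y T b)"
        using rep_reps[OF T b] by (simp add: x_def pick_rep[OF T b])
      have "y T b \<in> transfer b ` carrier (Mobj (stab G act (rep b)))"
        using ym[OF T b] transfer_bij[OF reps_in[OF T b]] by (simp add: bij_betw_def)
      then show ?thesis unfolding e by (simp add: inv_into_into f_inv_into_f)
    qed
    have "x \<in> (\<Pi>\<^sub>E a\<in>cell_reps G act Y A d. carrier (Mobj (stab G act a)))"
    proof (rule PiE_I)
      fix a assume "a \<in> cell_reps G act Y A d"
      then show "x a \<in> carrier (Mobj (stab G act a))" using rep_surj[of a d] xr by blast
    qed (simp add: x_def)
    \<comment> \<open>Here finiteness of \<open>I\<close> enters: the support of \<open>x\<close> is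
      covered by the images of the supports of the finitely many \<open>y T\<close>.\<close>
    moreover have "finite {a \<in> cell_reps G act Y A d. x a \<noteq> \<one>\<^bsub>Mobj (stab G act a)\<^esub>}"
    proof (rule finite_subset)
      show "finite (\<Union>T\<in>I. rep ` {b \<in> reps T d. y T b \<noteq> \<one>\<^bsub>Mobj (stab G act b)\<^esub>})"
        using finite_I y carrier_sub_chains by (auto simp: PiE_iff)
      show "{a \<in> cell_reps G act Y A d. x a \<noteq> \<one>\<^bsub>Mobj (stab G act a)\<^esub>}
        \<subseteq> (\<Union>T\<in>I. rep ` {b \<in> reps T d. y T b \<noteq> \<one>\<^bsub>Mobj (stab G act b)\<^esub>})"
      proof
        fix a assume "a \<in> {a \<in> cell_reps G act Y A d. x a \<noteq> \<one>\<^bsub>Mobj (stab G act a)\<^esub>}"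
        then have a: "a \<in> cell_reps G act Y A d" "x a \<noteq> \<one>\<^bsub>Mobj (stab G act a)\<^esub>" by auto
        obtain T b where T: "T \<in> I" and b: "b \<in> reps T d" "rep b = a" using rep_surj[OF a(1)] by blast
        have "y T b \<noteq> \<one>\<^bsub>Mobj (stab G act b)\<^esub>"
          using xr[OF T b(1)] transfer_eq_one_iff[OF reps_in[OF T b(1)], of "x a"] a(2) b(2) by auto
        then show "a \<in> (\<Union>T\<in>I. rep ` {b \<in> reps T d. y T b \<noteq> \<one>\<^bsub>Mobj (stab G act b)\<^esub>})" using T b by blast
      qed
    qed
    ultimately have xc: "x \<in> carrier (bredon_chains G act Y A Mobj d)" by (simp add: carrier_chains)
    have "y = (\<lambda>T\<in>I. restr T d x)"
    proof (rule extensionalityI[of _ I])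
      show "y \<in> extensional I" using y by (simp add: PiE_iff)
      fix T assume T: "T \<in> I"
      have "y T = restr T d x"
      proof (rule extensionalityI[of _ "reps T d"])
        show "y T \<in> extensional (reps T d)"
          using PiE_mem[OF y T] unfolding carrier_sub_chains[OF T] by (simp add: PiE_iff)
      qed (use xr[OF T] in \<open>simp_all add: restr_def\<close>)
      then show "y T = (\<lambda>T\<in>I. restr T d x) T" using T by simp
    qed simp
    then show "y \<in> (\<lambda>x. \<lambda>T\<in>I. restr T d x) ` carrier (bredon_chains G act Y A Mobj d)" using xc by blast
  qed
qed


text \<open>A naturality square for one face. By functoriality its two sides are
  \<open>M(R_u)\<close> with \<open>u\<close> equal to \<open>g \<otimes> mover b\<close> and to
  \<open>mover a \<otimes> k\<close>, where \<open>g\<close> and \<open>k\<close> are the elements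
  chosen in the global and the local differential. Both products carry \<open>b\<close> to the
  \<open>j\<close>-th face of \<open>rep a\<close>.\<close>

lemma restr_bd_term:
  assumes T: "T \<in> I" and b: "b \<in> reps T d" and x: "x \<in> carrier (bredon_chains G act Y A Mobj (Suc d))"
    and p: "(a, j) \<in> bredon_pair.bd_index (H T) act (Y' T) (A' T) d b"
    and p': "(rep a, j) \<in> bd_index d (rep b)"
  shows "transfer b (bd_term (rep b) x (rep a, j))
    = bredon_pair.bd_term (H T) act Mobj Mmap b (restr T (Suc d) x) (a, j)"
proof -
  interpret T: bredon_pair G "H T" act "Y' T" "A' T" F Mobj Mmap by (rule bredon_pair_sub[OF T])
  have a: "a \<in> reps T (Suc d)" using p by (simp add: T.bd_index_def)
  note aY = reps_in[OF T a] and bY = reps_in[OF T b]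
  note raY = orep_in[OF aY] and rbY = orep_in[OF bY]
  define g where "g = (SOME g. g \<in> carrier G \<and> map (act g) (rep b) = face j (rep a))"
  define k where "k = (SOME g. g \<in> carrier (H T) \<and> map (act g) b = face j a)"
  have g: "g \<in> carrier G" "map (act g) (rep b) = face j (rep a)"
    using bd_map_ex[OF rep_reps[OF T b] p'] unfolding g_def by blast+
  have k: "k \<in> carrier G" "map (act k) b = face j a"
    using T.bd_map_ex[OF b p] H_closed[OF T] unfolding k_def by blast+
  let ?e = "(- 1) ^ j :: int"
  let ?x = "x (rep a)"
  have xa: "?x \<in> carrier (Mobj (stab G act (rep a)))" by (rule chain_in[OF x rep_reps[OF T a]])
  have s1: "stab G act (rep a) \<subseteq> stab G act (map (act g) (rep b))" unfolding g(2) by (rule stab_face)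
  have s2: "stab G act a \<subseteq> stab G act (map (act k) b)" unfolding k(2) by (rule stab_face)
  have sa: "stab G act (rep a) \<subseteq> stab G act (map (act (mover a)) a)" by (simp add: mover(2)[OF aY])
  have sb: "stab G act (rep b) \<subseteq> stab G act (map (act (mover b)) b)" by (simp add: mover(2)[OF bY])
  have m1: "map (act (g \<otimes> mover b)) b = face j (rep a)"
    using act_mult[OF bY g(1) mover(1)[OF bY]] mover(2)[OF bY] g(2) by simp
  have m2: "map (act (mover a \<otimes> k)) b = face j (rep a)"
    using act_mult[OF bY mover(1)[OF aY] k(1)] mover(2)[OF aY] k(2) by (simp flip: face_map)
  have "transfer b (bd_term (rep b) x (rep a, j))
      = transfer b (Mmap (stab G act (rep a)) (stab G act (rep b)) g ?x) [^]\<^bsub>Mobj (stab G act b)\<^esub> ?e"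
    unfolding bd_term_def g_def[symmetric] prod.case
    by (rule hom_int_pow[OF transfer_hom[OF bY] hom_in_carrier[OF Mmap_hom[OF raY rbY g(1) s1] xa]
          Mobj_group[OF rbY] Mobj_group[OF bY]])
  also have "transfer b (Mmap (stab G act (rep a)) (stab G act (rep b)) g ?x)
      = Mmap (stab G act (rep a)) (stab G act b) (g \<otimes> mover b) ?x"
    unfolding transfer_def by (rule Mmap_comp[OF raY rbY bY g(1) mover(1)[OF bY] s1 sb xa])
  \<comment> \<open>The two elements carry \<open>b\<close> to the same cell, hence lie in one left
    coset of its stabiliser and induce the same map.\<close>
  also have "\<dots> = Mmap (stab G act (rep a)) (stab G act b) (mover a \<otimes> k) ?x"
    by (rule Mmap_cong[OF raY bY _ _ _ _ xa])
      (use g(1) k(1) mover(1)[OF aY] mover(1)[OF bY] stab_face[of "rep a" j] in \<open>simp_all add: m1 m2\<close>)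
  also have "\<dots> = Mmap (stab G act a) (stab G act b) k (transfer a ?x)"
    unfolding transfer_def by (rule Mmap_comp[OF raY aY bY mover(1)[OF aY] k(1) sa s2 xa, symmetric])
  finally show ?thesis
    using a by (simp add: T.bd_term_def k_def[symmetric] restr_def stab_reps[OF T a] stab_reps[OF T b])
qed

text \<open>The action moves chains vertex by vertex, so the mover of \<open>a\<close> takes the
  \<open>j\<close>-th face to the \<open>j\<close>-th face. The position \<open>j\<close>, and with
  it the incidence sign, is kept when \<open>a\<close> is replaced by \<open>rep a\<close>.\<close>

lemma restr_bd_index:
  assumes T: "T \<in> I" and b: "b \<in> reps T d" and x: "x \<in> carrier (bredon_chains G act Y A Mobj (Suc d))"
  shows "(\<lambda>(a, j). (rep a, j)) ` {p \<in> bredon_pair.bd_index (H T) act (Y' T) (A' T) d b.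
      restr T (Suc d) x (fst p) \<noteq> \<one>\<^bsub>Mobj (stab (H T) act (fst p))\<^esub>}
    = {p \<in> bd_index d (rep b). x (fst p) \<noteq> \<one>\<^bsub>Mobj (stab G act (fst p))\<^esub>}" (is "?f ` ?S' = ?S")
proof -
  interpret T: bredon_pair G "H T" act "Y' T" "A' T" F Mobj Mmap by (rule bredon_pair_sub[OF T])
  have ne: "restr T (Suc d) x a \<noteq> \<one>\<^bsub>Mobj (stab (H T) act a)\<^esub> \<longleftrightarrow> x (rep a) \<noteq> \<one>\<^bsub>Mobj (stab G act (rep a))\<^esub>"
    if a: "a \<in> reps T (Suc d)" for a
    using a transfer_eq_one_iff[OF reps_in[OF T a] chain_in[OF x rep_reps[OF T a]]]
    by (simp add: restr_def stab_reps[OF T a])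
  have fr: "face j (rep a) = map (act (mover a)) (face j a)" if "a \<in> Y - A" for a j
    using mover(2)[OF that] by (simp flip: face_map)
  show ?thesis
  proof (intro subset_antisym image_subsetI subsetI)
    fix p assume "p \<in> ?S'"
    then obtain a j where [simp]: "p = (a, j)" and p: "(a, j) \<in> T.bd_index d b"
      and n: "restr T (Suc d) x a \<noteq> \<one>\<^bsub>Mobj (stab (H T) act a)\<^esub>" by (cases p) auto
    have a: "a \<in> reps T (Suc d)" and j: "j \<le> Suc d" and f: "face j a \<in> Y' T - A' T" "length (face j a) = Suc d"
      and o: "orep (H T) act (face j a) = b" using p by (simp_all add: T.bd_index_def rel_cells_def)
    note aY = reps_in[OF T a] and fY = sub_cells[OF T f(1)]
    obtain h where h: "h \<in> carrier (H T)" "b = map (act h) (face j a)" using T.orep_ex[OF f(1)] o by blast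
    have "rep (face j (rep a)) = rep (face j a)"
      unfolding fr[OF aY] by (rule orep_translate[OF fY mover(1)[OF aY]])
    also have "\<dots> = rep b" unfolding h(2) by (rule orep_translate[OF fY H_closed[OF T h(1)], symmetric])
    finally have "rep (face j (rep a)) = rep b" .
    moreover have "face j (rep a) \<in> Y - A" unfolding fr[OF aY] by (rule act_closed[OF fY mover(1)[OF aY]])
    moreover have "length (face j (rep a)) = Suc d" unfolding fr[OF aY] using f(2) by simp
    ultimately show "?f p \<in> ?S" using rep_reps[OF T a] j n ne[OF a] by (simp add: bd_index_def rel_cells_def)
  next
    fix p assume "p \<in> ?S"
    then obtain a' j where p: "p = (a', j)" "(a', j) \<in> bd_index d (rep b)"
      and n: "x a' \<noteq> \<one>\<^bsub>Mobj (stab G act a')\<^esub>" by (cases p) auto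
    have a': "a' \<in> cell_reps G act Y A (Suc d)" and j: "j \<le> Suc d" and f: "face j a' \<in> Y - A" "length (face j a') = Suc d"
      and o: "rep (face j a') = rep b" using p(2) by (simp_all add: bd_index_def rel_cells_def)
    obtain U a where U: "U \<in> I" and a: "a \<in> reps U (Suc d)" "rep a = a'" using rep_surj[OF a'] by blast
    note aY = reps_in[OF U a(1)]
    have fe: "face j a = map (act (inv (mover a))) (face j a')"
      using act_inv[OF aY mover(1)[OF aY]] mover(2)[OF aY] a(2) by (simp flip: face_map)
    have fY: "face j a \<in> Y - A" unfolding fe by (rule act_closed[OF f(1)]) (simp add: mover(1)[OF aY])
    \<comment> \<open>A face surviving in \<open>Y - A\<close> stays in the piece of
      \<open>a\<close>. As it shares its orbit with \<open>b\<close>, \<open>separated\<close> then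
      forces \<open>U = T\<close>.\<close>
    have fU: "face j a \<in> Y' U - A' U" by (rule sub_face[OF U reps_sub[OF U a(1)] fY])
    have "rep (face j a) = rep b"
      unfolding fe using orep_translate[OF f(1), of "inv (mover a)"] o mover(1)[OF aY] by simp
    then have UT: "U = T" and o': "orep (H T) act b = orep (H T) act (face j a)"
      using rep_eq_imp[OF T U reps_sub[OF T b] fU] by auto
    have "orep (H T) act b = b" using b by (simp add: T.cell_reps_iff)
    moreover have "length (face j a) = Suc d" unfolding fe using f(2) by simp
    ultimately have "(a, j) \<in> T.bd_index d b"
      using a(1) UT j fU o' by (simp add: T.bd_index_def rel_cells_def)
    moreover have "restr T (Suc d) x a \<noteq> \<one>\<^bsub>Mobj (stab (H T) act a)\<^esub>" using ne[of a] a UT n by simp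
    ultimately have "(a, j) \<in> ?S'" by simp
    then show "p \<in> ?f ` ?S'" by (rule rev_image_eqI) (simp add: p(1) a(2))
  qed
qed

text \<open>The transport is a homomorphism and passes inside the product; the global index pairs
  are then reindexed by local ones, and the factors agree one by one.\<close>

lemma restr_bd:
  assumes T: "T \<in> I" and x: "x \<in> carrier (bredon_chains G act Y A Mobj (Suc d))"
  shows "restr T d (bredon_bd G act Y A Mobj Mmap d x)
    = bredon_bd (H T) act (Y' T) (A' T) Mobj Mmap d (restr T (Suc d) x)"
proof -
  interpret T: bredon_pair G "H T" act "Y' T" "A' T" F Mobj Mmap by (rule bredon_pair_sub[OF T])
  show ?thesis
  proof (rule extensionalityI[of _ "reps T d"])
    show "restr T d (bredon_bd G act Y A Mobj Mmap d x) \<in> extensional (reps T d)" by (simp add: restr_def)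
    show "bredon_bd (H T) act (Y' T) (A' T) Mobj Mmap d (restr T (Suc d) x) \<in> extensional (reps T d)"
      by (simp add: bredon_bd_def)
    fix b assume b: "b \<in> reps T d"
    note bY = reps_in[OF T b]
    let ?f = "\<lambda>(a, j). (rep a, j)"
    let ?S' = "{p \<in> T.bd_index d b. restr T (Suc d) x (fst p) \<noteq> \<one>\<^bsub>Mobj (stab (H T) act (fst p))\<^esub>}"
    let ?S = "{p \<in> bd_index d (rep b). x (fst p) \<noteq> \<one>\<^bsub>Mobj (stab G act (fst p))\<^esub>}"
    let ?h = "\<lambda>p. transfer b (bd_term (rep b) x p)"
    interpret M: comm_group "Mobj (stab G act b)" by (rule Mobj_comm_group[OF bY])
    note img = restr_bd_index[OF T b x]
    have bt: "bd_term (rep b) x p \<in> carrier (Mobj (stab G act (rep b)))" if "p \<in> bd_index d (rep b)" for p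
      by (rule bd_term_closed[OF rep_reps[OF T b] that x])
    have hS: "?h \<in> ?S \<rightarrow> carrier (Mobj (stab G act b))"
      using hom_in_carrier[OF transfer_hom[OF bY] bt] by blast
    have inj: "inj_on ?f ?S'"
    proof (rule inj_onI)
      fix p q assume p: "p \<in> ?S'" and q: "q \<in> ?S'" and eq: "?f p = ?f q"
      have "fst p \<in> reps T (Suc d)" "fst q \<in> reps T (Suc d)" using p q by (auto simp: T.bd_index_def)
      then show "p = q" using rep_inj[OF T T, of "fst p" "Suc d" "fst q"] eq by (auto simp: prod_eq_iff split_def)
    qed
    have eq: "?h (?f p) = T.bd_term b (restr T (Suc d) x) p" if p: "p \<in> ?S'" for p
    proof -
      obtain a j where [simp]: "p = (a, j)" by force
      have "(rep a, j) \<in> ?S" unfolding img[symmetric] using p by (intro image_eqI[of _ _ p]) simp_all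
      then show ?thesis using restr_bd_term[OF T b x, of a j] p by simp
    qed
    have "restr T d (bredon_bd G act Y A Mobj Mmap d x) b
        = transfer b (finprod (Mobj (stab G act (rep b))) (bd_term (rep b) x) ?S)"
      using b by (simp add: restr_def bd_apply_aux[OF rep_reps[OF T b]])
    also have "\<dots> = finprod (Mobj (stab G act b)) ?h ?S"
      by (rule hom_finprod[OF transfer_hom[OF bY] Mobj_comm_group[OF orep_in[OF bY]] Mobj_comm_group[OF bY]])
        (use bt in blast)
    also have "\<dots> = finprod (Mobj (stab G act b)) ?h (?f ` ?S')" by (simp only: img)
    also have "\<dots> = finprod (Mobj (stab G act b)) (\<lambda>p. ?h (?f p)) ?S'"
      by (rule M.finprod_reindex[OF _ inj]) (simp only: img hS)
    also have "\<dots> = finprod (Mobj (stab G act b)) (T.bd_term b (restr T (Suc d) x)) ?S'"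
    proof (rule M.finprod_cong'[OF HOL.refl])
      show "T.bd_term b (restr T (Suc d) x) \<in> ?S' \<rightarrow> carrier (Mobj (stab G act b))"
        using T.bd_term_closed[OF b _ hom_in_carrier[OF restr_hom[OF T] x]] stab_reps[OF T b] by auto
    qed (rule eq)
    also have "\<dots> = bredon_bd (H T) act (Y' T) (A' T) Mobj Mmap d (restr T (Suc d) x) b"
      by (simp add: T.bd_apply_aux[OF b] stab_reps[OF T b])
    finally show "restr T d (bredon_bd G act Y A Mobj Mmap d x) b
      = bredon_bd (H T) act (Y' T) (A' T) Mobj Mmap d (restr T (Suc d) x) b" .
  qed
qed

lemma restr_eqI:
  assumes "x \<in> carrier (bredon_chains G act Y A Mobj d)" "y \<in> carrier (bredon_chains G act Y A Mobj d)"
    and "\<And>T. T \<in> I \<Longrightarrow> restr T d x = restr T d y"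
  shows "x = y"
  by (rule inj_onD[OF bij_betw_imp_inj_on[OF restr_bij] _ assms(1,2)]) (rule restrict_ext, rule assms(3))

text \<open>Since \<open>restr\<close> is bijective on chains and commutes with the differentials, a
  chain is a cycle or a boundary exactly when all its restrictions are; the quotient is then split
  by \<open>iso_Mod_product\<close>.\<close>

theorem bredon_homology_iso:
  "bredon_homology G act Y A Mobj Mmap i
    \<cong> sum_group I (\<lambda>T. bredon_homology (H T) act (Y' T) (A' T) Mobj Mmap i)"
  unfolding bredon_homology_eq
proof (rule iso_Mod_product[OF finite_I _ restr_hom group_chains restr_bij])
  let ?C = "bredon_chains G act Y A Mobj" and ?D = "\<lambda>T. bredon_chains (H T) act (Y' T) (A' T) Mobj"
  let ?bd = "bredon_bd G act Y A Mobj Mmap" and ?bd' = "\<lambda>T. bredon_bd (H T) act (Y' T) (A' T) Mobj Mmap"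
  show "comm_group (?D T i)" if "T \<in> I" for T
    by (rule bredon_pair.comm_group_chains[OF bredon_pair_sub[OF that]])
  show "subgroup (bredon_cycles (H T) act (Y' T) (A' T) Mobj Mmap i) (?D T i)" if "T \<in> I" for T
    by (rule bredon_pair.subgroup_cycles[OF bredon_pair_sub[OF that]])
  show "subgroup (bredon_boundaries (H T) act (Y' T) (A' T) Mobj Mmap i) (?D T i)" if "T \<in> I" for T
    by (rule bredon_pair.subgroup_boundaries[OF bredon_pair_sub[OF that]])
  show "bredon_cycles G act Y A Mobj Mmap i
      = {x \<in> carrier (?C i). \<forall>T\<in>I. restr T i x \<in> bredon_cycles (H T) act (Y' T) (A' T) Mobj Mmap i}"
  proof (cases i)
    case 0
    then show ?thesis using hom_in_carrier[OF restr_hom] by (auto simp: bredon_cycles_def)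
  next
    case (Suc k)
    have "?bd k x = \<one>\<^bsub>?C k\<^esub> \<longleftrightarrow> (\<forall>T\<in>I. ?bd' T k (restr T (Suc k) x) = \<one>\<^bsub>?D T k\<^esub>)"
      if x: "x \<in> carrier (?C (Suc k))" for x
    proof -
      have one: "restr T k \<one>\<^bsub>?C k\<^esub> = \<one>\<^bsub>?D T k\<^esub>" if "T \<in> I" for T
        by (rule hom_one[OF restr_hom[OF that] group_chains bredon_pair.group_chains[OF bredon_pair_sub[OF that]]])
      have "?bd k x = \<one>\<^bsub>?C k\<^esub> \<longleftrightarrow> (\<forall>T\<in>I. restr T k (?bd k x) = restr T k \<one>\<^bsub>?C k\<^esub>)"
        using restr_eqI[OF hom_in_carrier[OF bredon_bd_hom x], of "\<one>\<^bsub>?C k\<^esub>"]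
          monoid.one_closed[OF group.is_monoid[OF group_chains]] by auto
      also have "\<dots> \<longleftrightarrow> (\<forall>T\<in>I. ?bd' T k (restr T (Suc k) x) = \<one>\<^bsub>?D T k\<^esub>)"
        by (simp add: one restr_bd[OF _ x])
      finally show ?thesis .
    qed
    then show ?thesis using hom_in_carrier[OF restr_hom] by (auto simp: bredon_cycles_def kernel_def Suc)
  qed
  show "bredon_boundaries G act Y A Mobj Mmap i
      = {x \<in> carrier (?C i). \<forall>T\<in>I. restr T i x \<in> bredon_boundaries (H T) act (Y' T) (A' T) Mobj Mmap i}"
  proof (intro subset_antisym subsetI)
    fix y assume "y \<in> bredon_boundaries G act Y A Mobj Mmap i"
    then obtain x where x: "x \<in> carrier (?C (Suc i))" "y = ?bd i x" by (auto simp: bredon_boundaries_def)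
    then show "y \<in> {x \<in> carrier (?C i). \<forall>T\<in>I. restr T i x \<in> bredon_boundaries (H T) act (Y' T) (A' T) Mobj Mmap i}"
      using hom_in_carrier[OF bredon_bd_hom x(1)] hom_in_carrier[OF restr_hom x(1)]
      by (auto simp: bredon_boundaries_def restr_bd)
  next
    fix y assume "y \<in> {x \<in> carrier (?C i). \<forall>T\<in>I. restr T i x \<in> bredon_boundaries (H T) act (Y' T) (A' T) Mobj Mmap i}"
    then have y: "y \<in> carrier (?C i)"
      and "\<forall>T\<in>I. \<exists>z. z \<in> carrier (?D T (Suc i)) \<and> restr T i y = ?bd' T i z" by (auto simp: bredon_boundaries_def)
    then obtain z where z: "\<And>T. T \<in> I \<Longrightarrow> z T \<in> carrier (?D T (Suc i)) \<and> restr T i y = ?bd' T i (z T)" by metis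
    \<comment> \<open>Local preimages, chosen separately for each \<open>T\<close>, are assembled
      into one global chain by surjectivity in degree \<open>Suc i\<close>.\<close>
    then have "restrict z I \<in> (\<lambda>x. \<lambda>T\<in>I. restr T (Suc i) x) ` carrier (?C (Suc i))"
      unfolding bij_betw_imp_surj_on[OF restr_bij] by auto
    then obtain x where x: "x \<in> carrier (?C (Suc i))" and "restrict z I = (\<lambda>T\<in>I. restr T (Suc i) x)" by blast
    then have zx: "z T = restr T (Suc i) x" if "T \<in> I" for T using that by (metis restrict_apply')
    have "y = ?bd i x"
      by (rule restr_eqI[OF y hom_in_carrier[OF bredon_bd_hom x]]) (simp add: restr_bd[OF _ x] z zx)
    then show "y \<in> bredon_boundaries G act Y A Mobj Mmap i" using x by (simp add: bredon_boundaries_def)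
  qed
qed

end

section \<open>The group given by the Coxeter presentation\<close>

lemma cox_eq_append:
  assumes "cox_eq N m u v"
  shows "cox_eq N m (a @ u @ b) (a @ v @ b)"
  using assms
proof induction
  case (rel r u v)
  show ?case using cox_eq.rel[OF rel, of "a @ u" "v @ b"] by simp
qed (auto intro: cox_eq.intros)

lemma cox_eq_append2:
  assumes "cox_eq N m u u'" "cox_eq N m v v'"
  shows "cox_eq N m (u @ v) (u' @ v')"
  using cox_eq_append[OF assms(1), of "[]" v] cox_eq_append[OF assms(2), of u' "[]"]
  by (auto intro: cox_eq.trans)

lemma cox_class_eq_iff:
  assumes "u \<in> lists {0..<N}"
  shows "cox_class N m u = cox_class N m v \<longleftrightarrow> cox_eq N m u v"
  using assms unfolding cox_class_def by (auto intro: cox_eq.intros)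

text \<open>The words picked by \<open>SOME\<close> are congruent to \<open>u\<close> and
  \<open>v\<close>, and the congruence respects concatenation.\<close>

lemma cox_mult_class:
  assumes "u \<in> lists {0..<N}" "v \<in> lists {0..<N}"
  shows "cox_mult N m (cox_class N m u) (cox_class N m v) = cox_class N m (u @ v)"
proof -
  have *: "(SOME x. x \<in> cox_class N m w) \<in> cox_class N m w" if "w \<in> lists {0..<N}" for w
    using that by (intro someI_ex[of "\<lambda>x. x \<in> cox_class N m w"]) (auto simp: cox_class_def intro: cox_eq.refl)
  show ?thesis
    unfolding cox_mult_def using *[OF assms(1)] *[OF assms(2)]
    by (subst cox_class_eq_iff) (auto simp: cox_class_def intro: cox_eq_append2)
qed

text \<open>The two adjacent middle letters form \<open>[i, i]\<close>, the relator for
  \<open>i = j\<close> with exponent \<open>m i i = 1\<close>, and cancel. Reversed words thus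
  represent inverses.\<close>

lemma cox_eq_append_rev:
  assumes "coxeter_matrix N m" "w \<in> lists {0..<N}"
  shows "cox_eq N m (rev w @ w) []"
  using assms(2)
proof (induction w rule: lists.induct)
  case (Cons i w)
  have "[i, i] \<in> cox_relators N m"
    using Cons.hyps assms(1) unfolding cox_relators_def coxeter_matrix_def
    by (intro CollectI exI[of _ i] exI[of _ "1::nat"]) (auto simp: one_enat_def)
  from cox_eq.rel[OF this, of "rev w" w] Cons.IH show ?case by (auto intro: cox_eq.trans)
qed (auto intro: cox_eq.refl)

lemma carrier_coxeter_group: "carrier (coxeter_group N m) = cox_class N m ` lists {0..<N}"
  and mult_coxeter_group: "monoid.mult (coxeter_group N m) = cox_mult N m"
  and one_coxeter_group: "\<one>\<^bsub>coxeter_group N m\<^esub> = cox_class N m []"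
  by (simp_all add: coxeter_group_def)

lemma group_coxeter_group:
  assumes "coxeter_matrix N m"
  shows "group (coxeter_group N m)"
proof (rule groupI)
  fix x assume "x \<in> carrier (coxeter_group N m)"
  then obtain w where w: "w \<in> lists {0..<N}" "x = cox_class N m w"
    by (auto simp: carrier_coxeter_group)
  have r: "rev w \<in> lists {0..<N}" using w(1) by auto
  have "cox_class N m (rev w) \<otimes>\<^bsub>coxeter_group N m\<^esub> x = \<one>\<^bsub>coxeter_group N m\<^esub>"
    using cox_eq_append_rev[OF assms w(1)] w r
    by (simp add: mult_coxeter_group one_coxeter_group cox_mult_class cox_class_eq_iff)
  then show "\<exists>y\<in>carrier (coxeter_group N m). y \<otimes>\<^bsub>coxeter_group N m\<^esub> x = \<one>\<^bsub>coxeter_group N m\<^esub>"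
    using r by (auto simp: carrier_coxeter_group)
qed (auto simp: carrier_coxeter_group mult_coxeter_group one_coxeter_group cox_mult_class in_listsI
    simp del: in_lists_conv_set)

section \<open>The dual geometric representation\<close>

text \<open>This is \<open>-2 B(alpha_i, alpha_j)\<close> for the canonical form
  \<open>B(alpha_i, alpha_j) = - cos (pi / m i j)\<close>: it equals -2 on the diagonal, and the
  value 2 at infinity corresponds to \<open>B = -1\<close>.\<close>

definition dual_coeff :: "(nat \<Rightarrow> nat \<Rightarrow> enat) \<Rightarrow> nat \<Rightarrow> nat \<Rightarrow> real" where
  "dual_coeff m i j = (case m i j of enat k \<Rightarrow> 2 * cos (pi / real k) | \<infinity> \<Rightarrow> 2)"

text \<open>The contragredient of the geometric representation in coordinates with respect to the
  basis of simple roots: the \<open>j\<close>-th coordinate of a functional is its value on the \<open>j\<close>-th root.\<close>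
definition dual_refl :: "(nat \<Rightarrow> nat \<Rightarrow> enat) \<Rightarrow> nat \<Rightarrow> (nat \<Rightarrow> real) \<Rightarrow> nat \<Rightarrow> real" where
  "dual_refl m i f = (\<lambda>j. f j + dual_coeff m i j * f i)"

definition dual_word :: "(nat \<Rightarrow> nat \<Rightarrow> enat) \<Rightarrow> nat list \<Rightarrow> (nat \<Rightarrow> real) \<Rightarrow> nat \<Rightarrow> real" where
  "dual_word m w f = foldr (dual_refl m) w f"

lemma dual_word_append: "dual_word m (u @ v) f = dual_word m u (dual_word m v f)"
  by (simp add: dual_word_def)

text \<open>Multiplying by \<open>2 sin \<theta>\<close> turns each sine into a difference of
  cosines, and the sum telescopes.\<close>

lemma sum_sin_progression:
  fixes \<theta> \<phi> :: real
  shows "2 * sin \<theta> * (\<Sum>s<n. sin (2 * real s * \<theta> + \<phi>)) = cos (\<phi> - \<theta>) - cos ((2 * real n - 1) * \<theta> + \<phi>)"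
proof (induction n)
  case (Suc n)
  have "2 * sin \<theta> * sin (2 * real n * \<theta> + \<phi>)
      = cos ((2 * real n * \<theta> + \<phi>) - \<theta>) - cos ((2 * real n * \<theta> + \<phi>) + \<theta>)"
    by (simp add: cos_diff cos_add)
  with Suc show ?case by (simp add: algebra_simps)
qed (simp add: algebra_simps)

text \<open>Applying the reflections \<open>j\<close>, \<open>i\<close> alternately, the coordinate being negated at step \<open>t\<close> is \<open>x t\<close>;
  these numbers satisfy the Chebyshev recursion \<open>x (t + 1) = 2 cos \<theta> * x t - x (t - 1)\<close>.\<close>
lemma dual_word_braid:
  fixes \<theta> :: real and f :: "nat \<Rightarrow> real" and i j :: nat
  defines "x \<equiv> \<lambda>t::real. (f j * sin ((t + 1) * \<theta>) + f i * sin (t * \<theta>)) / sin \<theta>"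
  assumes ii: "dual_coeff m i i = - 2" and jj: "dual_coeff m j j = - 2"
    and ij: "dual_coeff m i j = 2 * cos \<theta>" and ji: "dual_coeff m j i = 2 * cos \<theta>"
    and s: "sin \<theta> \<noteq> 0"
  shows "dual_word m (concat (replicate k [i, j])) f = (\<lambda>l. f l
      + dual_coeff m j l * (\<Sum>s<k. x (2 * real s)) + dual_coeff m i l * (\<Sum>s<k. x (2 * real s + 1)))
    \<and> f j + dual_coeff m j j * (\<Sum>s<k. x (2 * real s)) + dual_coeff m i j * (\<Sum>s<k. x (2 * real s + 1)) = x (2 * real k)
    \<and> f i + dual_coeff m j i * (\<Sum>s<k. x (2 * real s)) + dual_coeff m i i * (\<Sum>s<k. x (2 * real s + 1)) = - x (2 * real k - 1)"
proof (induction k)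
  \<comment> \<open>The combination of sines in \<open>x\<close> is fixed by its initial values
    \<open>x 0 = f j\<close> and \<open>x (-1) = - f i\<close>.\<close>
  case 0
  then show ?case using s by (simp add: x_def dual_word_def)
next
  case (Suc k)
  define g where "g = dual_word m (concat (replicate k [i, j])) f"
  have rec: "x (t + 1) = 2 * cos \<theta> * x t - x (t - 1)" for t
  proof -
    have e: "sin ((t + 2) * \<theta>) = 2 * cos \<theta> * sin ((t + 1) * \<theta>) - sin (t * \<theta>)" for t
    proof -
      have "sin ((t + 2) * \<theta>) = sin ((t + 1) * \<theta> + \<theta>)" "sin (t * \<theta>) = sin ((t + 1) * \<theta> - \<theta>)"
        by (simp_all add: algebra_simps)
      then show ?thesis by (simp add: sin_add sin_diff)
    qed
    have sx: "sin \<theta> * x u = f j * sin ((u + 1) * \<theta>) + f i * sin (u * \<theta>)" for u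
      using s by (simp add: x_def)
    have "sin \<theta> * x (t + 1) = f j * sin ((t + 2) * \<theta>) + f i * sin (((t - 1) + 2) * \<theta>)"
      unfolding sx by (simp add: add.commute)
    also have "\<dots> = 2 * cos \<theta> * (sin \<theta> * x t) - sin \<theta> * x (t - 1)"
      unfolding sx e by (simp add: algebra_simps)
    also have "\<dots> = sin \<theta> * (2 * cos \<theta> * x t - x (t - 1))" by (simp add: algebra_simps)
    finally show ?thesis using s by simp
  qed
  \<comment> \<open>The last two conjuncts are the coordinates \<open>j\<close> and \<open>i\<close>
    in closed form; they supply the two values from which the recursion continues.\<close>
  have gj: "g j = x (2 * real k)" and gi: "g i = - x (2 * real k - 1)"
    and gl: "g l = f l + dual_coeff m j l * (\<Sum>s<k. x (2 * real s)) + dual_coeff m i l * (\<Sum>s<k. x (2 * real s + 1))" for l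
    using Suc by (simp_all add: g_def)
  have com: "concat (replicate (Suc k) [i, j]) = [i, j] @ concat (replicate k [i, j])" by simp
  have h: "dual_word m (concat (replicate (Suc k) [i, j])) f = dual_refl m i (dual_refl m j g)"
    unfolding com dual_word_append g_def by (simp add: dual_word_def)
  have r1: "x (2 * real k + 1) = 2 * cos \<theta> * x (2 * real k) - x (2 * real k - 1)" by (rule rec)
  have r2: "x (2 * real k + 2) = 2 * cos \<theta> * x (2 * real k + 1) - x (2 * real k)"
    using rec[of "2 * real k + 1"] by (simp add: algebra_simps)
  have A: "dual_refl m i (dual_refl m j g) = (\<lambda>l. g l + dual_coeff m j l * x (2 * real k) + dual_coeff m i l * x (2 * real k + 1))"
  proof
    fix l
    have "g i + dual_coeff m j i * g j = x (2 * real k + 1)" using r1 by (simp add: gi gj ji)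
    then show "dual_refl m i (dual_refl m j g) l
        = g l + dual_coeff m j l * x (2 * real k) + dual_coeff m i l * x (2 * real k + 1)"
      by (simp add: dual_refl_def gj)
  qed
  show ?case
    unfolding h A gl
    using r1 r2 gl[of i] gl[of j] gi gj ii jj ij ji
    by (auto simp: algebra_simps)
qed

text \<open>By \<open>dual_word_braid\<close>, the \<open>k\<close>-th power of the product of two
  reflections changes \<open>f\<close> only by two sums of \<open>x\<close> over even and odd
  arguments. With \<open>\<theta> = pi / k\<close> both sums run through a full period and
  vanish.\<close>

lemma dual_word_relator:
  assumes m: "coxeter_matrix N m" and r: "r \<in> cox_relators N m"
  shows "dual_word m r f = f"
proof -
  obtain i j k where r: "r = concat (replicate k [i, j])" and ij: "i < N" "j < N" and k: "m i j = enat k"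
    using r by (auto simp: cox_relators_def)
  have diag: "dual_coeff m l l = - 2" if "l < N" for l
    using m that by (auto simp: coxeter_matrix_def dual_coeff_def one_enat_def)
  show ?thesis
  proof (cases "i = j")
    case True
    then have "k = 1" using k m ij by (auto simp: coxeter_matrix_def one_enat_def)
    then show ?thesis using diag ij True by (auto simp: r dual_word_def dual_refl_def)
  next
    case False
    then have k2: "2 \<le> k" using m ij k unfolding coxeter_matrix_def
      by (metis enat_ord_simps(1) numeral_eq_enat)
    define \<theta> where "\<theta> = pi / real k"
    have s: "sin \<theta> > 0" using k2 unfolding \<theta>_def
      by (intro sin_gt_zero) (auto simp: field_simps)
    have kt: "real k * \<theta> = pi" using k2 by (simp add: \<theta>_def)
    have c: "dual_coeff m i j = 2 * cos \<theta>" "dual_coeff m j i = 2 * cos \<theta>"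
      using m ij k by (auto simp: dual_coeff_def \<theta>_def coxeter_matrix_def) 
    define x where "x = (\<lambda>t::real. (f j * sin ((t + 1) * \<theta>) + f i * sin (t * \<theta>)) / sin \<theta>)"
    \<comment> \<open>The end points of the telescoping sum are cosines of angles that differ by
      \<open>2 * k * \<theta> = 2 pi\<close>.\<close>
    have z: "(\<Sum>s<k. sin (2 * real s * \<theta> + \<phi>)) = 0" for \<phi>
    proof -
      have "(2 * real k - 1) * \<theta> + \<phi> = (\<phi> - \<theta>) + 2 * pi" using kt by (simp add: algebra_simps)
      then have "cos ((2 * real k - 1) * \<theta> + \<phi>) = cos (\<phi> - \<theta>)" by (metis cos_periodic)
      then show ?thesis using sum_sin_progression[of \<theta> \<phi> k] s by simp
    qed
    have "(\<Sum>s<k. x (2 * real s)) = (f j * (\<Sum>s<k. sin (2 * real s * \<theta> + \<theta>)) + f i * (\<Sum>s<k. sin (2 * real s * \<theta> + 0))) / sin \<theta>"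
      by (simp add: x_def sum_distrib_left sum.distrib flip: sum_divide_distrib) (simp add: algebra_simps)
    then have 1: "(\<Sum>s<k. x (2 * real s)) = 0" unfolding z by simp
    have "(\<Sum>s<k. x (2 * real s + 1)) = (f j * (\<Sum>s<k. sin (2 * real s * \<theta> + 2 * \<theta>)) + f i * (\<Sum>s<k. sin (2 * real s * \<theta> + \<theta>))) / sin \<theta>"
      by (simp add: x_def sum_distrib_left sum.distrib flip: sum_divide_distrib) (simp add: algebra_simps)
    then have 2: "(\<Sum>s<k. x (2 * real s + 1)) = 0" unfolding z by simp
    show ?thesis
      using dual_word_braid[of m i j \<theta> k f] diag ij c s 1 2 by (simp add: r x_def)
  qed
qed

lemma dual_word_cong:
  assumes "coxeter_matrix N m" "cox_eq N m u v"
  shows "dual_word m u f = dual_word m v f"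
  using assms(2)
proof (induction arbitrary: f)
  case (rel r u v)
  then show ?case by (simp add: dual_word_append dual_word_relator[OF assms(1)])
qed auto

section \<open>Special subgroups and their generating sets\<close>

lemma cox_gen_closed: "i < N \<Longrightarrow> cox_gen N m i \<in> carrier (coxeter_group N m)"
  by (auto simp: cox_gen_def carrier_coxeter_group)

lemma inv_cox_gen:
  assumes m: "coxeter_matrix N m" and i: "i < N"
  shows "inv\<^bsub>coxeter_group N m\<^esub> (cox_gen N m i) = cox_gen N m i"
proof (rule group.inv_equality[OF group_coxeter_group[OF m]])
  show "cox_gen N m i \<otimes>\<^bsub>coxeter_group N m\<^esub> cox_gen N m i = \<one>\<^bsub>coxeter_group N m\<^esub>"
    using cox_eq_append_rev[OF m, of "[i]"] i
    by (simp add: mult_coxeter_group one_coxeter_group cox_gen_def cox_mult_class cox_class_eq_iff)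
qed (use i cox_gen_closed in auto)

text \<open>Generators are their own inverses, so the inverses allowed in \<open>generate\<close>
  bring no letters outside \<open>T\<close>.\<close>

lemma special_subgroup_words:
  assumes m: "coxeter_matrix N m" and T: "T \<subseteq> {0..<N}"
  shows "special_subgroup N m T \<subseteq> cox_class N m ` lists T"
proof
  fix g assume "g \<in> special_subgroup N m T"
  then show "g \<in> cox_class N m ` lists T" unfolding special_subgroup_def
  proof (induction rule: generate.induct)
    case one
    then show ?case by (simp add: one_coxeter_group)
  next
    case (incl h)
    then show ?case by (auto simp: cox_gen_def)
  next
    case (inv h)
    then obtain i where "i \<in> T" "h = cox_gen N m i" by auto
    with T show ?case by (subst \<open>h = _\<close>, subst inv_cox_gen[OF m]) (auto simp: cox_gen_def)
  next
    case (eng h1 h2)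
    then obtain u v where "u \<in> lists T" "v \<in> lists T" "h1 = cox_class N m u" "h2 = cox_class N m v"
      by blast
    moreover from this have "u \<in> lists {0..<N}" "v \<in> lists {0..<N}" using T lists_mono by blast+
    ultimately show ?case by (auto simp: mult_coxeter_group cox_mult_class simp del: in_lists_conv_set
        intro!: imageI)
  qed
qed

lemma cox_gen_in_special_subgroup_iff:
  assumes m: "coxeter_matrix N m" and T: "T \<subseteq> {0..<N}" and i: "i < N"
  shows "cox_gen N m i \<in> special_subgroup N m T \<longleftrightarrow> i \<in> T"
proof
  assume "cox_gen N m i \<in> special_subgroup N m T"
  then obtain w where w: "w \<in> lists T" "cox_class N m [i] = cox_class N m w"
    using special_subgroup_words[OF m T] unfolding cox_gen_def by blast
  then have eq: "cox_eq N m [i] w" using i by (simp add: cox_class_eq_iff)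
  \<comment> \<open>This functional vanishes on the roots in \<open>T\<close>, so it is fixed by the special subgroup but not by the generator \<open>i\<close>.\<close>
  define f where "f = (\<lambda>j. if j = i then 1 else 0 :: real)"
  show "i \<in> T"
  proof (rule ccontr)
    assume "i \<notin> T"
    with w(1) have "dual_word m w f = f"
      by (induction w) (auto simp: dual_word_def dual_refl_def f_def fun_eq_iff)
    then have "dual_word m [i] f = f" using dual_word_cong[OF m eq, of f] by simp
    \<comment> \<open>The left side is \<open>1 - 2 = -1\<close>, because the diagonal coefficient
      is \<open>2 cos pi\<close>.\<close>
    then have "dual_refl m i f i = f i" by (simp add: dual_word_def)
    then show False using m i by (auto simp: dual_refl_def dual_coeff_def f_def coxeter_matrix_def one_enat_def)
  qed
qed (auto simp: special_subgroup_def intro: generate.incl)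

text \<open>\<open>T\<close> is recovered from its special subgroup as the set of those
  \<open>i\<close> whose generator lies in it.\<close>

lemma special_subgroup_mono_iff:
  assumes m: "coxeter_matrix N m" and "T \<subseteq> {0..<N}" "U \<subseteq> {0..<N}"
  shows "special_subgroup N m T \<subseteq> special_subgroup N m U \<longleftrightarrow> T \<subseteq> U"
proof
  assume "special_subgroup N m T \<subseteq> special_subgroup N m U"
  then show "T \<subseteq> U" using assms(2,3) cox_gen_in_special_subgroup_iff[OF m]
    by (meson atLeastLessThan_iff subset_iff)
next
  assume "T \<subseteq> U"
  then show "special_subgroup N m T \<subseteq> special_subgroup N m U"
    unfolding special_subgroup_def by (intro group.mono_generate[OF group_coxeter_group[OF m]] image_mono)
qed

lemma subgroup_special_subgroup:
  assumes m: "coxeter_matrix N m" and "T \<subseteq> {0..<N}"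
  shows "subgroup (special_subgroup N m T) (coxeter_group N m)"
  unfolding special_subgroup_def using assms
  by (intro group.generate_is_subgroup[OF group_coxeter_group[OF m]]) (auto intro!: cox_gen_closed)

lemma carrier_special_group:
  assumes "T \<subseteq> {0..<N}"
  shows "carrier (special_group N m T) = special_subgroup N m T"
proof -
  have "carrier (coxeter_group N m) \<inter> cox_gen N m ` T = cox_gen N m ` T"
    using assms by (auto intro!: cox_gen_closed)
  then show ?thesis by (simp add: special_group_def special_subgroup_def carrier_subgroup_generated)
qed

section \<open>Cells of the Davis complex\<close>

text \<open>A sublist of a strictly sorted list is strictly sorted. The second hypothesis excludes
  deleting the only vertex of a one-element chain.\<close>

lemma face_order_chain:
  assumes "c \<in> order_chains lt V" "face j c \<noteq> []"
  shows "face j c \<in> order_chains lt V"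
proof -
  have s: "sorted_wrt lt c" "set c \<subseteq> V" using assms by (auto simp: order_chains_def)
  have "sorted_wrt lt (take j c @ drop j c)" using s by simp
  then have "sorted_wrt lt (face j c)"
    unfolding face_def sorted_wrt_append using set_drop_subset_set_drop[of j "Suc j" c]
    by (auto intro: sorted_wrt_drop s(1))
  moreover have "set (face j c) \<subseteq> set c" by (auto simp: face_def dest: in_set_takeD in_set_dropD)
  ultimately show ?thesis using assms(2) s(2) by (auto simp: order_chains_def)
qed

locale coxeter_system =
  fixes N :: nat and m :: "nat \<Rightarrow> nat \<Rightarrow> enat"
  assumes cox: "coxeter_matrix N m"
begin

abbreviation "W \<equiv> coxeter_group N m"
abbreviation "WT \<equiv> special_subgroup N m"
abbreviation "vact \<equiv> coset_act N m"

sublocale W: group W by (rule group_coxeter_group[OF cox])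

lemma WT_subgroup: "T \<subseteq> {0..<N} \<Longrightarrow> subgroup (WT T) W"
  by (rule subgroup_special_subgroup[OF cox])

lemma WT_carrier: "T \<subseteq> {0..<N} \<Longrightarrow> g \<in> WT T \<Longrightarrow> g \<in> carrier W"
  using subgroup.subset[OF WT_subgroup] by blast

lemma coset_self:
  assumes "T \<subseteq> {0..<N}" "w \<in> carrier W"
  shows "w \<in> w <#\<^bsub>W\<^esub> WT T"
  using subgroup.one_closed[OF WT_subgroup[OF assms(1)]] assms(2) W.r_one[OF assms(2)]
  unfolding l_coset_def by force

text \<open>\<open>w\<close> lies in the larger coset, so \<open>v W_U = w W_U\<close>; cancelling
  \<open>w\<close> leaves \<open>W_T \<subseteq> W_U\<close>. Inclusion of cosets is thereby reduced
  to inclusion of generating sets.\<close>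

lemma coset_subset_imp:
  assumes T: "T \<subseteq> {0..<N}" and U: "U \<subseteq> {0..<N}" and w: "w \<in> carrier W" and v: "v \<in> carrier W"
    and sub: "w <#\<^bsub>W\<^esub> WT T \<subseteq> v <#\<^bsub>W\<^esub> WT U"
  shows "T \<subseteq> U \<and> inv\<^bsub>W\<^esub> v \<otimes>\<^bsub>W\<^esub> w \<in> WT U"
proof
  have wv: "w \<in> v <#\<^bsub>W\<^esub> WT U" using coset_self[OF T w] sub by blast
  then obtain h where h: "h \<in> WT U" "w = v \<otimes>\<^bsub>W\<^esub> h" by (auto simp: l_coset_def)
  then show "inv\<^bsub>W\<^esub> v \<otimes>\<^bsub>W\<^esub> w \<in> WT U" using v WT_carrier[OF U h(1)] by (simp flip: W.m_assoc)
  have eq: "v <#\<^bsub>W\<^esub> WT U = w <#\<^bsub>W\<^esub> WT U" by (rule W.l_repr_independence[OF wv v WT_subgroup[OF U]])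
  have "WT T \<subseteq> WT U"
  proof
    fix g assume g: "g \<in> WT T"
    then have "w \<otimes>\<^bsub>W\<^esub> g \<in> w <#\<^bsub>W\<^esub> WT T" by (auto simp: l_coset_def)
    then have "w \<otimes>\<^bsub>W\<^esub> g \<in> w <#\<^bsub>W\<^esub> WT U" using sub eq by blast
    then obtain u where u: "u \<in> WT U" "w \<otimes>\<^bsub>W\<^esub> g = w \<otimes>\<^bsub>W\<^esub> u" by (auto simp: l_coset_def)
    then have "g = u" using w WT_carrier[OF T g] WT_carrier[OF U u(1)] by simp
    then show "g \<in> WT U" using u by simp
  qed
  then show "T \<subseteq> U" using special_subgroup_mono_iff[OF cox T U] by simp
qed

section \<open>Vertices of the Davis complex and the action on them\<close>

lemma spherical_subset: "spherical N m T \<Longrightarrow> T \<subseteq> {0..<N}"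
  by (simp add: spherical_def)

lemma davis_vertexE:
  assumes "p \<in> davis_vertices N m"
  obtains w T where "w \<in> carrier W" "spherical N m T" "T \<subseteq> {0..<N}" "p = (w <#\<^bsub>W\<^esub> WT T, T)"
  using assms unfolding davis_vertices_def by (auto simp: spherical_def)

lemma davis_vertex_carrier:
  assumes "p \<in> davis_vertices N m" shows "fst p \<subseteq> carrier W"
  using assms by (rule davis_vertexE) (simp add: W.l_coset_subset_G subgroup.subset[OF WT_subgroup])

lemma vact_vertex:
  assumes w: "w \<in> carrier W" and g: "g \<in> carrier W" and T: "T \<subseteq> {0..<N}"
  shows "vact g (w <#\<^bsub>W\<^esub> WT T, T) = ((g \<otimes>\<^bsub>W\<^esub> w) <#\<^bsub>W\<^esub> WT T, T)"
  using W.lcos_m_assoc[OF subgroup.subset[OF WT_subgroup[OF T]] g w] by (simp add: coset_act_def)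

lemma vact_closed:
  assumes "p \<in> davis_vertices N m" "g \<in> carrier W"
  shows "vact g p \<in> davis_vertices N m"
  using assms(1)
proof (rule davis_vertexE)
  fix w T assume a: "w \<in> carrier W" "spherical N m T" "T \<subseteq> {0..<N}" "p = (w <#\<^bsub>W\<^esub> WT T, T)"
  have "vact g p = ((g \<otimes>\<^bsub>W\<^esub> w) <#\<^bsub>W\<^esub> WT T, T)" unfolding a(4) by (rule vact_vertex[OF a(1) assms(2) a(3)])
  then show "vact g p \<in> davis_vertices N m" unfolding davis_vertices_def using a(1,2) assms(2) by blast
qed

text \<open>The law relies on cosets consisting of group elements, as does \<open>vact_mult\<close>.
  The abstract locales accordingly ask for the action laws on cells only.\<close>

lemma vact_one: "p \<in> davis_vertices N m \<Longrightarrow> vact \<one>\<^bsub>W\<^esub> p = p"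
  using W.lcos_mult_one[OF davis_vertex_carrier] by (simp add: coset_act_def)

lemma vact_mult:
  "p \<in> davis_vertices N m \<Longrightarrow> g \<in> carrier W \<Longrightarrow> h \<in> carrier W \<Longrightarrow> vact (g \<otimes>\<^bsub>W\<^esub> h) p = vact g (vact h p)"
  using W.lcos_m_assoc[OF davis_vertex_carrier] by (simp add: coset_act_def)

text \<open>Translation by \<open>g\<close> is undone by its inverse, so a proper inclusion stays
  proper.\<close>

lemma vact_less:
  assumes p: "p \<in> davis_vertices N m" and q: "q \<in> davis_vertices N m" and g: "g \<in> carrier W" and less: "coset_less p q"
  shows "coset_less (vact g p) (vact g q)"
proof -
  have inv: "inv\<^bsub>W\<^esub> g <#\<^bsub>W\<^esub> (g <#\<^bsub>W\<^esub> fst r) = fst r" if "r \<in> davis_vertices N m" for r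
    using W.lcos_m_assoc[OF davis_vertex_carrier[OF that], of "inv\<^bsub>W\<^esub> g" g] g
      W.lcos_mult_one[OF davis_vertex_carrier[OF that]] by simp
  have "g <#\<^bsub>W\<^esub> fst p \<subseteq> g <#\<^bsub>W\<^esub> fst q" using less by (auto simp: coset_less_def l_coset_def)
  moreover have "g <#\<^bsub>W\<^esub> fst p \<noteq> g <#\<^bsub>W\<^esub> fst q" using inv[OF p] inv[OF q] less by (metis coset_less_def psubset_eq)
  ultimately show ?thesis by (auto simp: coset_less_def coset_act_def)
qed

lemma vact_chain:
  assumes c: "c \<in> order_chains coset_less (davis_vertices N m)" and g: "g \<in> carrier W"
    and V: "\<And>p. p \<in> set c \<Longrightarrow> vact g p \<in> V"
  shows "map (vact g) c \<in> order_chains coset_less V"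
proof -
  have s: "sorted_wrt coset_less c" "c \<noteq> []" "set c \<subseteq> davis_vertices N m" using c by (auto simp: order_chains_def)
  have "sorted_wrt coset_less (map (vact g) c)" unfolding sorted_wrt_map
    by (rule sorted_wrt_mono_rel[OF _ s(1)]) (use vact_less[OF _ _ g] s(3) in blast)
  then show ?thesis using s(2) V by (auto simp: order_chains_def)
qed

section \<open>Top vertices, skeleta and relative cells\<close>

lemma chain_last:
  assumes "c \<in> order_chains coset_less V" "p \<in> set c"
  shows "fst p \<subseteq> fst (last c)"
proof -
  have c: "c = butlast c @ [last c]" and s: "sorted_wrt coset_less c" using assms(1) by (auto simp: order_chains_def)
  have "\<forall>p\<in>set (butlast c). coset_less p (last c)" using s by (subst (asm) c) (simp add: sorted_wrt_append)
  moreover have "p \<in> set (butlast c) \<or> p = last c" using assms(2) by (subst (asm) c) auto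
  ultimately show ?thesis by (auto simp: coset_less_def)
qed

lemma last_in: "c \<in> order_chains lt V \<Longrightarrow> last c \<in> V"
  by (auto simp: order_chains_def)

text \<open>The top vertex is the smallest possible witness: any coset containing it has at least as
  many generators, by \<open>coset_subset_imp\<close>.\<close>

lemma davis_skeleton_iff:
  "c \<in> davis_skeleton N m k \<longleftrightarrow>
    c \<in> order_chains coset_less (davis_vertices N m) \<and> int (card (snd (last c))) \<le> k"
proof (intro iffI conjI)
  assume "c \<in> davis_skeleton N m k"
  then obtain q where c: "c \<in> order_chains coset_less (davis_vertices N m)"
    and q: "q \<in> davis_vertices N m" "int (card (snd q)) \<le> k" "\<forall>p\<in>set c. fst p \<subseteq> fst q"
    by (auto simp: davis_skeleton_def)
  show "c \<in> order_chains coset_less (davis_vertices N m)" by (rule c)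
  obtain w T where p: "w \<in> carrier W" "T \<subseteq> {0..<N}" "last c = (w <#\<^bsub>W\<^esub> WT T, T)"
    using davis_vertexE[OF last_in[OF c]] by metis
  obtain v U where q': "v \<in> carrier W" "U \<subseteq> {0..<N}" "q = (v <#\<^bsub>W\<^esub> WT U, U)"
    using davis_vertexE[OF q(1)] by metis
  have "last c \<in> set c" using c by (auto simp: order_chains_def)
  then have "w <#\<^bsub>W\<^esub> WT T \<subseteq> v <#\<^bsub>W\<^esub> WT U" using q(3) p(3) q'(3) by fastforce
  then have "T \<subseteq> U" using coset_subset_imp[OF p(2) q'(2) p(1) q'(1)] by simp
  then have "card T \<le> card U" using q'(2) by (meson card_mono finite_atLeastLessThan finite_subset)
  then show "int (card (snd (last c))) \<le> k" using q(2) p(3) q'(3) by simp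
next
  assume "c \<in> order_chains coset_less (davis_vertices N m) \<and> int (card (snd (last c))) \<le> k"
  then show "c \<in> davis_skeleton N m k"
    using chain_last[of c "davis_vertices N m"] last_in[of c coset_less "davis_vertices N m"]
    unfolding davis_skeleton_def by blast
qed

text \<open>The integer index covers \<open>n = 0\<close> uniformly: no cardinality is at most -1,
  so the skeleton removed there is empty.\<close>

lemma relative_skeleton_iff:
  "c \<in> davis_skeleton N m (int n) - davis_skeleton N m (int n - 1) \<longleftrightarrow>
    c \<in> order_chains coset_less (davis_vertices N m) \<and> card (snd (last c)) = n"
  by (auto simp: davis_skeleton_iff)

text \<open>Subsets of a spherical set are spherical, their special subgroups being contained in a
  finite one.\<close>

lemma cell_vertex_davis:
  assumes T: "spherical N m T" and p: "p \<in> cell_vertices N m T"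
  shows "p \<in> davis_vertices N m"
proof -
  obtain w U where w: "w \<in> WT T" and U: "U \<subseteq> T" and p: "p = (w <#\<^bsub>W\<^esub> WT U, U)" using p by (auto simp: cell_vertices_def)
  have TN: "T \<subseteq> {0..<N}" by (rule spherical_subset[OF T])
  have "WT U \<subseteq> WT T" using special_subgroup_mono_iff[OF cox, of U T] U TN by blast
  then have "spherical N m U" using T U TN by (auto simp: spherical_def intro: finite_subset)
  then show ?thesis unfolding p davis_vertices_def using WT_carrier[OF TN w] by blast
qed

lemma top_vertex: "spherical N m T \<Longrightarrow> w \<in> WT T \<Longrightarrow> w <#\<^bsub>W\<^esub> WT T = WT T"
  by (rule W.coset_join3[OF WT_carrier WT_subgroup]) (auto simp: spherical_def)

text \<open>If the top vertex is not \<open>W_T\<close>, then it is itself a proper coset above the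
  whole chain and places the chain in the boundary; if it is, no proper coset can contain
  it.\<close>

lemma relative_cell_iff:
  assumes T: "spherical N m T"
  shows "c \<in> coxeter_cell N m T - coxeter_cell_boundary N m T \<longleftrightarrow>
    c \<in> order_chains coset_less (cell_vertices N m T) \<and> last c = (WT T, T)"
proof -
  have TN: "T \<subseteq> {0..<N}" by (rule spherical_subset[OF T])
  have "(\<exists>q\<in>cell_vertices N m T. fst q \<subset> WT T \<and> (\<forall>p\<in>set c. fst p \<subseteq> fst q)) \<longleftrightarrow> last c \<noteq> (WT T, T)"
    if c: "c \<in> order_chains coset_less (cell_vertices N m T)"
  proof
    assume "\<exists>q\<in>cell_vertices N m T. fst q \<subset> WT T \<and> (\<forall>p\<in>set c. fst p \<subseteq> fst q)"
    then obtain q where "q \<in> cell_vertices N m T" "fst q \<subset> WT T" "\<forall>p\<in>set c. fst p \<subseteq> fst q" by blast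
    moreover have "last c \<in> set c" using c by (auto simp: order_chains_def)
    ultimately show "last c \<noteq> (WT T, T)" by force
  next
    assume ne: "last c \<noteq> (WT T, T)"
    obtain w U where w: "w \<in> WT T" and U: "U \<subseteq> T" and l: "last c = (w <#\<^bsub>W\<^esub> WT U, U)"
      using last_in[OF c] by (auto simp: cell_vertices_def)
    have UN: "U \<subseteq> {0..<N}" using U TN by blast
    have wW: "w \<in> carrier W" by (rule WT_carrier[OF TN w])
    have "WT U \<subseteq> WT T" using special_subgroup_mono_iff[OF cox UN TN] U by simp
    then have "w <#\<^bsub>W\<^esub> WT U \<subseteq> w <#\<^bsub>W\<^esub> WT T" by (auto simp: l_coset_def)
    then have sub: "fst (last c) \<subseteq> WT T" using l top_vertex[OF T w] by simp
    \<comment> \<open>Vertices are tagged, so a coset equal to \<open>W_T\<close> as a set but with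
      a smaller tag \<open>U\<close> has to be excluded.\<close>
    have "fst (last c) \<noteq> WT T"
    proof
      assume e: "fst (last c) = WT T"
      then have "w <#\<^bsub>W\<^esub> WT T \<subseteq> w <#\<^bsub>W\<^esub> WT U" using l top_vertex[OF T w] by simp
      then have "T \<subseteq> U" using coset_subset_imp[OF TN UN wW wW] by simp
      then show False using U l ne e by auto
    qed
    then show "\<exists>q\<in>cell_vertices N m T. fst q \<subset> WT T \<and> (\<forall>p\<in>set c. fst p \<subseteq> fst q)"
      using sub last_in[OF c] chain_last[OF c] by blast
  qed
  then show ?thesis
    unfolding coxeter_cell_def coxeter_cell_boundary_def Diff_iff mem_Collect_eq by meson
qed

section \<open>Coxeter cells as induced pieces of the relative skeleta\<close>

lemma vact_one_chain:
  "c \<in> order_chains coset_less (davis_vertices N m) \<Longrightarrow> map (vact \<one>\<^bsub>W\<^esub>) c = c"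
  by (rule map_idI) (auto simp: order_chains_def vact_one)

lemma vact_mult_chain:
  "c \<in> order_chains coset_less (davis_vertices N m) \<Longrightarrow> g \<in> carrier W \<Longrightarrow> h \<in> carrier W \<Longrightarrow>
    map (vact (g \<otimes>\<^bsub>W\<^esub> h)) c = map (vact g) (map (vact h) c)"
  by (auto simp: order_chains_def vact_mult)

text \<open>An element that fixes the chain fixes its top vertex \<open>w W_T\<close>, and so lies
  in the finite set \<open>w W_T w^-1\<close>.\<close>

lemma stab_finite_subgroup:
  assumes c: "c \<in> order_chains coset_less (davis_vertices N m)"
  shows "stab W vact c \<in> fin_subgroups W"
proof -
  obtain w T where w: "w \<in> carrier W" "spherical N m T" "T \<subseteq> {0..<N}" "last c = (w <#\<^bsub>W\<^esub> WT T, T)"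
    using davis_vertexE[OF last_in[OF c]] by metis
  have ne: "c \<noteq> []" using c by (simp add: order_chains_def)
  have "subgroup (stab W vact c) W"
  proof (rule W.subgroupI)
    have "\<one>\<^bsub>W\<^esub> \<in> stab W vact c" using vact_one_chain[OF c] by (simp add: stab_def)
    then show "stab W vact c \<noteq> {}" by blast
    show "stab W vact c \<subseteq> carrier W" by (auto simp: stab_def)
  next
    fix g assume "g \<in> stab W vact c"
    then show "inv\<^bsub>W\<^esub> g \<in> stab W vact c"
      using vact_mult_chain[OF c, of "inv\<^bsub>W\<^esub> g" g] vact_one_chain[OF c] by (simp add: stab_def del: map_map)
  next
    fix g h assume "g \<in> stab W vact c" "h \<in> stab W vact c"
    then show "g \<otimes>\<^bsub>W\<^esub> h \<in> stab W vact c" using vact_mult_chain[OF c, of g h] by (simp add: stab_def del: map_map)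
  qed
  moreover have "finite (stab W vact c)"
  proof (rule finite_subset)
    show "finite ((\<lambda>x. x \<otimes>\<^bsub>W\<^esub> inv\<^bsub>W\<^esub> w) ` (w <#\<^bsub>W\<^esub> WT T))"
      using w(2) by (auto simp: l_coset_def spherical_def)
    show "stab W vact c \<subseteq> (\<lambda>x. x \<otimes>\<^bsub>W\<^esub> inv\<^bsub>W\<^esub> w) ` (w <#\<^bsub>W\<^esub> WT T)"
    proof
      fix g assume "g \<in> stab W vact c"
      then have g: "g \<in> carrier W" "map (vact g) c = c" by (simp_all add: stab_def)
      then have "vact g (last c) = last c" using ne last_map[of c "vact g"] by simp
      then have "(g \<otimes>\<^bsub>W\<^esub> w) <#\<^bsub>W\<^esub> WT T = w <#\<^bsub>W\<^esub> WT T" unfolding w(4) vact_vertex[OF w(1) g(1) w(3)] by simp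
      then have "g \<otimes>\<^bsub>W\<^esub> w \<in> w <#\<^bsub>W\<^esub> WT T" using coset_self[OF w(3), of "g \<otimes>\<^bsub>W\<^esub> w"] g(1) w(1) by simp
      moreover have "g = (g \<otimes>\<^bsub>W\<^esub> w) \<otimes>\<^bsub>W\<^esub> inv\<^bsub>W\<^esub> w" using g(1) w(1) by (simp add: W.m_assoc)
      ultimately show "g \<in> (\<lambda>x. x \<otimes>\<^bsub>W\<^esub> inv\<^bsub>W\<^esub> w) ` (w <#\<^bsub>W\<^esub> WT T)" by blast
    qed
  qed
  ultimately show ?thesis by (simp add: fin_subgroups_def)
qed

lemma relative_cell_skeleton:
  assumes T: "spherical N m T" "card T = n" and c: "c \<in> coxeter_cell N m T - coxeter_cell_boundary N m T"
  shows "c \<in> davis_skeleton N m (int n) - davis_skeleton N m (int n - 1)"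
  using c cell_vertex_davis[OF T(1)] T(2)
  unfolding relative_cell_iff[OF T(1)] relative_skeleton_iff by (auto simp: order_chains_def)

lemma meets_relative_cell:
  assumes c: "c \<in> davis_skeleton N m (int n) - davis_skeleton N m (int n - 1)"
  shows "\<exists>T\<in>{T. spherical N m T \<and> card T = n}. \<exists>g\<in>carrier W.
    map (vact g) c \<in> coxeter_cell N m T - coxeter_cell_boundary N m T"
proof -
  have ch: "c \<in> order_chains coset_less (davis_vertices N m)" and n: "card (snd (last c)) = n"
    using c unfolding relative_skeleton_iff by blast+
  obtain w T where w: "w \<in> carrier W" "spherical N m T" "T \<subseteq> {0..<N}" "last c = (w <#\<^bsub>W\<^esub> WT T, T)"
    using davis_vertexE[OF last_in[OF ch]] by metis
  \<comment> \<open>The vertices below \<open>w W_T\<close> are the cosets \<open>v W_U\<close> with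
    \<open>U \<subseteq> T\<close> and \<open>w^-1 v \<in> W_T\<close>; their translates are faces
    of the standard cell.\<close>
  have "vact (inv\<^bsub>W\<^esub> w) p \<in> cell_vertices N m T" if p: "p \<in> set c" for p
  proof -
    have "p \<in> davis_vertices N m" using ch p by (auto simp: order_chains_def)
    then obtain v U where v: "v \<in> carrier W" "U \<subseteq> {0..<N}" "p = (v <#\<^bsub>W\<^esub> WT U, U)"
      using davis_vertexE by metis
    have "v <#\<^bsub>W\<^esub> WT U \<subseteq> w <#\<^bsub>W\<^esub> WT T" using chain_last[OF ch p] v(3) w(4) by simp
    then have "U \<subseteq> T \<and> inv\<^bsub>W\<^esub> w \<otimes>\<^bsub>W\<^esub> v \<in> WT T" by (rule coset_subset_imp[OF v(2) w(3) v(1) w(1)])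
    moreover have "vact (inv\<^bsub>W\<^esub> w) p = ((inv\<^bsub>W\<^esub> w \<otimes>\<^bsub>W\<^esub> v) <#\<^bsub>W\<^esub> WT U, U)"
      unfolding v(3) by (rule vact_vertex[OF v(1) _ v(2)]) (simp add: w(1))
    ultimately show ?thesis unfolding cell_vertices_def by blast
  qed
  then have "map (vact (inv\<^bsub>W\<^esub> w)) c \<in> order_chains coset_less (cell_vertices N m T)"
    by (intro vact_chain[OF ch]) (simp_all add: w(1))
  moreover have "last (map (vact (inv\<^bsub>W\<^esub> w)) c) = (WT T, T)"
  proof -
    have "last (map (vact (inv\<^bsub>W\<^esub> w)) c) = vact (inv\<^bsub>W\<^esub> w) (last c)"
      using ch by (simp add: order_chains_def last_map)
    also have "\<dots> = (WT T, T)"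
      unfolding w(4) using vact_vertex[OF w(1) _ w(3), of "inv\<^bsub>W\<^esub> w"] w(1)
        W.lcos_mult_one[OF subgroup.subset[OF WT_subgroup[OF w(3)]]] by simp
    finally show ?thesis .
  qed
  ultimately have "map (vact (inv\<^bsub>W\<^esub> w)) c \<in> coxeter_cell N m T - coxeter_cell_boundary N m T"
    unfolding relative_cell_iff[OF w(2)] by blast
  moreover have "card T = n" using n w(4) by simp
  ultimately show ?thesis using w(1,2) W.inv_closed by blast
qed

text \<open>The action keeps tags, so comparing top vertices gives \<open>U = T\<close> in the
  second component and \<open>g W_T = W_T\<close> in the first.\<close>

lemma relative_cell_separated:
  assumes T: "spherical N m T" and U: "spherical N m U"
    and c: "c \<in> coxeter_cell N m T - coxeter_cell_boundary N m T" and g: "g \<in> carrier W"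
    and gc: "map (vact g) c \<in> coxeter_cell N m U - coxeter_cell_boundary N m U"
  shows "U = T \<and> g \<in> WT T"
proof -
  have "c \<noteq> []" "last c = (WT T, T)" using c unfolding relative_cell_iff[OF T] by (auto simp: order_chains_def)
  then have "last (map (vact g) c) = (g <#\<^bsub>W\<^esub> WT T, T)" by (simp add: last_map coset_act_def)
  moreover have "last (map (vact g) c) = (WT U, U)" using gc unfolding relative_cell_iff[OF U] by blast
  ultimately have "(g <#\<^bsub>W\<^esub> WT T, T) = (WT U, U)" by (rule subst)
  then show ?thesis using coset_self[OF spherical_subset[OF T] g] by auto
qed

lemma relative_cell_closed:
  assumes T: "spherical N m T" and g: "g \<in> WT T"
    and c: "c \<in> coxeter_cell N m T - coxeter_cell_boundary N m T"
  shows "map (vact g) c \<in> coxeter_cell N m T - coxeter_cell_boundary N m T"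
proof -
  have TN: "T \<subseteq> {0..<N}" by (rule spherical_subset[OF T])
  have gW: "g \<in> carrier W" by (rule WT_carrier[OF TN g])
  have ch: "c \<in> order_chains coset_less (cell_vertices N m T)" and l: "last c = (WT T, T)" and ne: "c \<noteq> []"
    using c unfolding relative_cell_iff[OF T] by (auto simp: order_chains_def)
  have ch': "c \<in> order_chains coset_less (davis_vertices N m)"
    using ch cell_vertex_davis[OF T] by (auto simp: order_chains_def)
  have "vact g p \<in> cell_vertices N m T" if p: "p \<in> set c" for p
  proof -
    have "p \<in> cell_vertices N m T" using ch p by (auto simp: order_chains_def)
    then obtain v U where v: "v \<in> WT T" "U \<subseteq> T" "p = (v <#\<^bsub>W\<^esub> WT U, U)" by (auto simp: cell_vertices_def)
    have "vact g p = ((g \<otimes>\<^bsub>W\<^esub> v) <#\<^bsub>W\<^esub> WT U, U)"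
      unfolding v(3) by (rule vact_vertex[OF WT_carrier[OF TN v(1)] gW]) (use v(2) TN in blast)
    moreover have "g \<otimes>\<^bsub>W\<^esub> v \<in> WT T" by (rule subgroup.m_closed[OF WT_subgroup[OF TN] g v(1)])
    ultimately show ?thesis unfolding cell_vertices_def using v(2) by blast
  qed
  then have "map (vact g) c \<in> order_chains coset_less (cell_vertices N m T)" by (rule vact_chain[OF ch' gW])
  moreover have "last (map (vact g) c) = (WT T, T)"
    using ne l top_vertex[OF T g] by (simp add: last_map coset_act_def)
  ultimately show ?thesis unfolding relative_cell_iff[OF T] by blast
qed

text \<open>The top of the face is a coset with tag \<open>U \<subseteq> T\<close>. Surviving in the
  relative skeleton means \<open>card U = card T\<close>, so \<open>U = T\<close> and the top vertex
  has been kept.\<close>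

lemma relative_cell_face:
  assumes T: "spherical N m T" "card T = n" and c: "c \<in> coxeter_cell N m T - coxeter_cell_boundary N m T"
    and f: "face j c \<in> davis_skeleton N m (int n) - davis_skeleton N m (int n - 1)"
  shows "face j c \<in> coxeter_cell N m T - coxeter_cell_boundary N m T"
proof -
  have ne: "face j c \<noteq> []" and n: "card (snd (last (face j c))) = n"
    using f unfolding relative_skeleton_iff by (auto simp: order_chains_def)
  have ch: "face j c \<in> order_chains coset_less (cell_vertices N m T)"
    using c ne unfolding relative_cell_iff[OF T(1)] by (blast intro: face_order_chain)
  obtain w U where w: "w \<in> WT T" "U \<subseteq> T" "last (face j c) = (w <#\<^bsub>W\<^esub> WT U, U)"
    using last_in[OF ch] by (auto simp: cell_vertices_def)
  have "finite T" using spherical_subset[OF T(1)] finite_subset by blast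
  then have "U = T" using w(2,3) n T(2) by (simp add: card_subset_eq)
  then have "last (face j c) = (WT T, T)" using w(3) top_vertex[OF T(1) w(1)] by simp
  then show ?thesis unfolding relative_cell_iff[OF T(1)] using ch by blast
qed

text \<open>The restricted module \<open>M_T\<close> is given by the same \<open>Mobj\<close> and
  \<open>Mmap\<close>: subgroups of \<open>W_T\<close> are subgroups of \<open>W\<close>, so one
  coefficient system serves both sides.\<close>

lemma induced_cells_davis:
  assumes "bredon_module W (fin_subgroups W) Mobj Mmap"
  shows "induced_cells W vact (davis_skeleton N m (int n)) (davis_skeleton N m (int n - 1))
    (fin_subgroups W) Mobj Mmap {T. spherical N m T \<and> card T = n} (special_group N m)
    (coxeter_cell N m) (coxeter_cell_boundary N m)"
proof (intro induced_cells.intro bredon_pair.intro bredon_pair_axioms.intro induced_cells_axioms.intro)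
  show "group W" by (rule W.is_group)
  show "bredon_module W (fin_subgroups W) Mobj Mmap" by (rule assms)
  show "subgroup (carrier W) W" by (rule W.subgroup_self)
  show "finite {T. spherical N m T \<and> card T = n}"
    by (rule finite_subset[of _ "Pow {0..<N}"]) (auto simp: spherical_def)
next
  fix c assume c: "c \<in> davis_skeleton N m (int n) - davis_skeleton N m (int n - 1)"
  then have ch: "c \<in> order_chains coset_less (davis_vertices N m)" and n: "card (snd (last c)) = n"
    unfolding relative_skeleton_iff by blast+
  show "map (vact \<one>\<^bsub>W\<^esub>) c = c" by (rule vact_one_chain[OF ch])
  show "stab W vact c \<in> fin_subgroups W" by (rule stab_finite_subgroup[OF ch])
  show "\<exists>T\<in>{T. spherical N m T \<and> card T = n}. \<exists>g\<in>carrier W.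
      map (vact g) c \<in> coxeter_cell N m T - coxeter_cell_boundary N m T"
    by (rule meets_relative_cell[OF c])
  fix g assume g: "g \<in> carrier W"
  have "map (vact g) c \<in> order_chains coset_less (davis_vertices N m)"
    by (rule vact_chain[OF ch g]) (use ch vact_closed[OF _ g] in \<open>auto simp: order_chains_def\<close>)
  moreover have "card (snd (last (map (vact g) c))) = n"
    using n ch by (simp add: order_chains_def last_map coset_act_def)
  ultimately show "map (vact g) c \<in> davis_skeleton N m (int n) - davis_skeleton N m (int n - 1)"
    unfolding relative_skeleton_iff by blast
  fix h assume h: "h \<in> carrier W"
  show "map (vact (g \<otimes>\<^bsub>W\<^esub> h)) c = map (vact g) (map (vact h) c)" by (rule vact_mult_chain[OF ch g h])
next
  fix T assume "T \<in> {T. spherical N m T \<and> card T = n}"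
  then have T: "spherical N m T" "card T = n" by auto
  note carr = carrier_special_group[OF spherical_subset[OF T(1)]]
  show "subgroup (carrier (special_group N m T)) W"
    unfolding carr by (rule WT_subgroup[OF spherical_subset[OF T(1)]])
  fix c assume c: "c \<in> coxeter_cell N m T - coxeter_cell_boundary N m T"
  show "c \<in> davis_skeleton N m (int n) - davis_skeleton N m (int n - 1)"
    by (rule relative_cell_skeleton[OF T c])
  show "face j c \<in> coxeter_cell N m T - coxeter_cell_boundary N m T"
    if "face j c \<in> davis_skeleton N m (int n) - davis_skeleton N m (int n - 1)" for j
    by (rule relative_cell_face[OF T c that])
  show "map (vact g) c \<in> coxeter_cell N m T - coxeter_cell_boundary N m T"
    if "g \<in> carrier (special_group N m T)" for g
    using that unfolding carr by (rule relative_cell_closed[OF T(1) _ c])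
  show "U = T \<and> g \<in> carrier (special_group N m T)"
    if "U \<in> {T. spherical N m T \<and> card T = n}" "g \<in> carrier W"
      "map (vact g) c \<in> coxeter_cell N m U - coxeter_cell_boundary N m U" for U g
    unfolding carr using that by (intro relative_cell_separated[OF T(1) _ c]) auto
qed

end

theorem theorem5p1:
  fixes N :: nat and m :: "nat \<Rightarrow> nat \<Rightarrow> enat"
    and Mobj :: "nat list set set \<Rightarrow> 'b monoid"
    and Mmap :: "nat list set set \<Rightarrow> nat list set set \<Rightarrow> nat list set \<Rightarrow> 'b \<Rightarrow> 'b"
    and n i :: nat
  assumes "coxeter_matrix N m"
    and "bredon_module (coxeter_group N m) (fin_subgroups (coxeter_group N m)) Mobj Mmap"
  shows "bredon_homology (coxeter_group N m) (coset_act N m)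
            (davis_skeleton N m (int n)) (davis_skeleton N m (int n - 1)) Mobj Mmap i
         \<cong> sum_group {T. spherical N m T \<and> card T = n}
            (\<lambda>T. bredon_homology (special_group N m T) (coset_act N m)
                   (coxeter_cell N m T) (coxeter_cell_boundary N m T) Mobj Mmap i)"
  using induced_cells.bredon_homology_iso[OF coxeter_system.induced_cells_davis[OF coxeter_system.intro]] assms
  by blast

end
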